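(* Let $p\geq 80$ be a prime and let $m$ be an integer in $[2,p-2]$. Let $c=c(p)\in(0,1)$ be the solution of the equation $$\Big(7+\sqrt{8\,c\,p\sin(\pi/p)/\sin(\pi c/3)+9}\Big)\,c=4+\frac{12}{p}.$$ Then $d_m(\mathbb{Z}/p\mathbb{Z})<c$. In particular, for every integer $m\geq 3$, $d_m\leq \frac{1}{3.1955}$.
   Context: For a positive integer $m$, a subset $A$ of an abelian group is $m$-sum-free if there is no triple $(x,y,z)\in A^3$ with $x+y=mz$. For a prime $p$, $d_m(\mathbb{Z}/p\mathbb{Z})=\max\{|A|/p : A\subseteq \mathbb{Z}/p\mathbb{Z}\ \text{is } m\text{-sum-free}\}$. For $m\ge 3$ it is known (from prior work) that $d_m(\mathbb{Z}/p\mathbb{Z})$ converges as $p\to\infty$ through primes; $d_m$ denotes this limit. *)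

theory Defs
  imports "HOL-Analysis.Analysis" "HOL-Computational_Algebra.Primes"
begin

definition m_sum_free_mod :: "nat \<Rightarrow> nat \<Rightarrow> nat set \<Rightarrow> bool" where
  "m_sum_free_mod p m A \<longleftrightarrow> A \<subseteq> {..<p} \<and>
     (\<forall>x\<in>A. \<forall>y\<in>A. \<forall>z\<in>A. (x + y) mod p \<noteq> (m * z) mod p)"

definition d_mod :: "nat \<Rightarrow> nat \<Rightarrow> real" where
  "d_mod m p = real (Max (card ` {A. m_sum_free_mod p m A})) / real p"

definition primes_at_top :: "nat filter" where
  "primes_at_top = inf at_top (principal {p. prime p})"

end

theory Submission
  imports Defs "HOL-Library.Set_Algebras" "HOL-Number_Theory.Cong" "HOL-Real_Asymp.Real_Asymp"
begin

text \<open>Let \<open>A\<close> be \<open>m\<close>-sum-free modulo \<open>p\<close> with \<open>N \<ge> c p\<close> elements. Since no sum of two elements of \<open>A\<close>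
  lies in \<open>m A\<close>, Parseval gives a Fourier coefficient of \<open>A\<close> of size at least \<open>N\<^sup>2 / (p - N)\<close>, so some
  dilate of \<open>A\<close> has many elements in a half arc. The equation for \<open>c\<close> makes the
  largest such part \<open>B\<close> (over all affine images of \<open>A\<close>) satisfy \<open>p - N \<le> 3 \<bar>B\<bar> - 4\<close>. As
  \<open>\<bar>B + B\<bar> \<le> p - N\<close>, Freiman's \<open>3k - 4\<close> theorem puts \<open>B\<close> into a short progression and a long interval
  into \<open>B + B\<close>. The set \<open>E = m A\<close> avoids this interval, hence \<open>E - B\<close> involves no wrap-around
  modulo \<open>p\<close> and again contains a long interval; this one is avoided by \<open>A\<close>. So \<open>A\<close> lies in a half arc
  and \<open>B = A\<close> by maximality. Now both \<open>A\<close> and \<open>m A\<close> fill a large part of an interval of length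
  \<open>p - 2 N + 1\<close>, which is impossible for a multiplier \<open>m\<close> different from \<open>0\<close>, \<open>1\<close> and \<open>-1\<close>.\<close>

section \<open>Sumsets of dense sets of integers\<close>

text \<open>The equation for \<open>c\<close> marks where two estimates of a Fourier coefficient
  collide. Let \<open>n\<close> be the size of the largest part and suppose \<open>3 n + N\<close>
  is at most \<open>p + 3\<close>. Then \<open>M = 2 n - N\<close> is at most
  \<open>(2 p + 6 - 5 c p) / 3\<close>. As the points of a dilate of \<open>A\<close> are distinct
  residues, their exponential sum is at most \<open>sin (pi M / p) / sin (pi / p)\<close>, hence at
  most \<open>k sin (pi c / 3) / sin (pi / p)\<close> with \<open>k = 2 / c + 6 / (c p) - 5\<close>.
  Parseval excludes this if \<open>k (k + 3) / 2 \<le> c p sin (pi / p) / sin (pi c / 3)\<close>; in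
  the case of equality, solving for \<open>k\<close> gives the displayed equation, whose square root
  is \<open>2 k + 3\<close>. For large \<open>p\<close> the right side tends to
  \<open>pi c / sin (pi c / 3)\<close>, and \<open>c = 1 / 3.1955\<close> satisfies the limiting
  inequality with little to spare. Half arcs matter because their elements add without wrap-around,
  so that the combinatorics takes place in the integers. Freiman's theorem also needs greatest
  common divisor 1, which maximality of the part alone does not give; hence a maximal part of least
  diameter is taken.\<close>

lemma midpoint_in_sumset:
  fixes U V :: "int set"
  assumes "U \<subseteq> {l..h}" "V \<subseteq> {l..h}" "l \<le> h + 1"
    and card: "int (card U) + int (card V) > h - l + 1"
  shows "l + h \<in> U + V"
proof -
  have fin: "finite U" "finite V"
    using assms finite_subset by blast+
  let ?V = "(\<lambda>v. l + h - v) ` V"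
  have cV: "card ?V = card V"
    by (rule card_image) (auto simp: inj_on_def)
  have "U \<inter> ?V \<noteq> {}"
  proof
    assume "U \<inter> ?V = {}"
    then have "card (U \<union> ?V) = card U + card V"
      using card_Un_disjoint[of U ?V] fin cV by simp
    moreover have "card (U \<union> ?V) \<le> card {l..h}"
      using assms(1,2) by (intro card_mono) auto
    ultimately show False
      using card \<open>l \<le> h + 1\<close> by simp
  qed
  then obtain v where "v \<in> V" "l + h - v \<in> U"
    by auto
  then have "(l + h - v) + v \<in> U + V"
    by (rule set_plus_intro[rotated])
  then show ?thesis
    by simp
qed

text \<open>The translates \<open>Min X + Y\<close> and \<open>X + Max Y\<close> meet at most in
  \<open>Min X + Max Y\<close>.\<close>

lemma card_sumset_ge:
  fixes X Y :: "int set"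
  assumes "finite X" "finite Y" "X \<noteq> {}" "Y \<noteq> {}"
  shows "card X + card Y \<le> card (X + Y) + 1"
proof -
  let ?S = "(\<lambda>y. Min X + y) ` Y" and ?T = "(\<lambda>x. x + Max Y) ` X"
  have "?S \<inter> ?T \<subseteq> {Min X + Max Y}"
  proof
    fix z assume "z \<in> ?S \<inter> ?T"
    then obtain x y where "x \<in> X" "y \<in> Y" "z = Min X + y" "z = x + Max Y"
      by auto
    moreover from this have "Min X \<le> x" "y \<le> Max Y"
      using assms by auto
    ultimately show "z \<in> {Min X + Max Y}"
      by auto
  qed
  then have "card (?S \<inter> ?T) \<le> 1"
    using card_mono[of "{Min X + Max Y}"] by simp
  moreover have "card (?S \<union> ?T) + card (?S \<inter> ?T) = card X + card Y"
    using card_Un_Int[of ?S ?T] assms by (simp add: card_image inj_on_def)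
  moreover have "card (?S \<union> ?T) \<le> card (X + Y)"
    using assms by (intro card_mono finite_set_plus) (auto intro!: set_plus_intro Min_in Max_in)
  ultimately show ?thesis
    by linarith
qed

text \<open>A walk that encodes the holes of \<open>X + Y\<close>: it starts at 0 for
  \<open>z = - 1\<close> and changes by at most 1 per step. High values force \<open>z\<close> into
  the sumset, low values force \<open>z + a\<close>, so two holes at different heights must be far
  apart.\<close>

definition excess :: "int set \<Rightarrow> int set \<Rightarrow> int \<Rightarrow> int" where
  "excess X Y z = int (card (X \<inter> {0..z})) + int (card (Y \<inter> {0..z})) - (z + 1)"

lemma card_Int_step:
  fixes X :: "int set"
  assumes "0 \<le> z"
  shows "card (X \<inter> {0..z}) = card (X \<inter> {0..z - 1}) + (if z \<in> X then 1 else 0)"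
proof (cases "z \<in> X")
  case True
  then have "X \<inter> {0..z} = insert z (X \<inter> {0..z - 1})"
    using assms by auto
  then show ?thesis
    using True by simp
next
  case False
  then have "X \<inter> {0..z} = X \<inter> {0..z - 1}"
    by (auto simp: order_le_less)
  then show ?thesis
    using False by simp
qed

lemma excess_step:
  assumes "0 \<le> z"
  shows "excess X Y z = excess X Y (z - 1) - 1 + (if z \<in> X then 1 else 0) + (if z \<in> Y then 1 else 0)"
  using assms by (simp add: excess_def card_Int_step[of z])

lemma excess_minus_one [simp]: "excess X Y (- 1) = 0"
  by (simp add: excess_def)

lemma mem_sumset_if_excess_pos:
  assumes "0 \<le> z" "0 < excess X Y z"
  shows "z \<in> X + Y"
proof -
  have "0 + z \<in> (X \<inter> {0..z}) + (Y \<inter> {0..z})"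
    using assms by (intro midpoint_in_sumset) (auto simp: excess_def)
  then show ?thesis
    using set_plus_mono2[of "X \<inter> {0..z}" X "Y \<inter> {0..z}" Y] by auto
qed

lemma card_Int_split:
  fixes X :: "int set"
  assumes "X \<subseteq> {0..a}" "0 \<le> z"
  shows "card X = card (X \<inter> {0..z - 1}) + card (X \<inter> {z..a})"
proof -
  have "X = (X \<inter> {0..z - 1}) \<union> (X \<inter> {z..a})"
    using assms by auto
  moreover have "card \<dots> = card (X \<inter> {0..z - 1}) + card (X \<inter> {z..a})"
    by (rule card_Un_disjoint) auto
  ultimately show ?thesis
    by argo
qed

text \<open>Few elements below \<open>z\<close> means many in \<open>{z..a}\<close>: there the two
  sets together have more than \<open>a - z + 1\<close> elements, and \<open>z + a\<close> is the
  sum of the end points of this interval.\<close>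

lemma mem_sumset_if_excess_small:
  assumes "X \<subseteq> {0..a}" "Y \<subseteq> {0..a}" "0 \<le> z" "z \<le> a + 1"
    and "excess X Y (z - 1) \<le> int (card X) + int (card Y) - a - 2"
  shows "z + a \<in> X + Y"
proof -
  have "z + a \<in> (X \<inter> {z..a}) + (Y \<inter> {z..a})"
    using assms card_Int_split[OF assms(1,3)] card_Int_split[OF assms(2,3)]
    by (intro midpoint_in_sumset) (auto simp: excess_def)
  then show ?thesis
    using set_plus_mono2[of "X \<inter> {z..a}" X "Y \<inter> {z..a}" Y] by auto
qed

lemma excess_lipschitz:
  assumes "- 1 \<le> x" "x \<le> y"
  shows "excess X Y y \<le> excess X Y x + (y - x)"
  using assms(2)
proof (induction y rule: int_ge_induct)
  case base
  then show ?case by simp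
next
  case (step y)
  then show ?case
    using excess_step[of "y + 1" X Y] assms(1) by (auto split: if_splits)
qed

text \<open>A hole at \<open>z\<close> means excess at most 0 there, hence at most 1 one step
  earlier, and the cardinality hypothesis puts 1 below the threshold that yields
  \<open>z + a\<close>.\<close>

lemma covered_mod_diameter:
  assumes "X \<subseteq> {0..a}" "Y \<subseteq> {0..a}" "0 \<in> X" "0 \<in> Y" "a + 3 \<le> int (card X) + int (card Y)"
    and "0 \<le> z" "z \<le> a" "z \<notin> X + Y"
  shows "z + a \<in> X + Y"
proof (rule mem_sumset_if_excess_small)
  have "excess X Y z \<le> 0"
    using mem_sumset_if_excess_pos[of z X Y] assms(6,8) by linarith
  then show "excess X Y (z - 1) \<le> int (card X) + int (card Y) - a - 2"
    using excess_step[OF assms(6), of X Y] assms(5) by (auto split: if_splits)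
qed (use assms in auto)

text \<open>Reduction modulo the diameter \<open>a\<close>: every residue class meets \<open>X + Y\<close>, and the classes
  of \<open>Y \<union> Z\<close> meet it twice.\<close>

lemma card_sumset_ge_diameter:
  fixes X Y Z :: "int set"
  assumes X: "X \<subseteq> {0..a}" "0 \<in> X" "a \<in> X" and Y: "Y \<subseteq> {0..a}" "0 \<in> Y"
    and card: "a + 3 \<le> int (card X) + int (card Y)"
    and Z: "Z \<subseteq> {0..<a} - Y" "Z \<subseteq> X + Y" "(\<lambda>z. z + a) ` Z \<subseteq> X + Y"
  shows "a + int (card Y) + int (card Z) \<le> int (card (X + Y))"
proof -
  have fin: "finite X" "finite Y" "finite Z"
    using X Y Z(1) finite_subset by blast+
  have a: "0 \<le> a"
    using X by auto
  define W1 where "W1 = {0..<a} \<inter> (X + Y)"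
  define W2 where "W2 = {0..<a} \<inter> {z. z + a \<in> X + Y}"
  \<comment> \<open>The class of 0 can be met three times: if \<open>a\<close> is in
    \<open>Y\<close>, then \<open>a + a\<close> is in the sumset. Counting it makes up for the
    element \<open>a\<close> of \<open>Y\<close> that \<open>{0..<a}\<close> omits.\<close>
  define W3 where "W3 = {a} \<inter> {z. z + a \<in> X + Y}"
  have YS: "y \<in> X + Y" "y + a \<in> X + Y" if "y \<in> Y" for y
    using set_plus_intro[OF X(2) that] set_plus_intro[OF X(3) that] by (auto simp: add.commute)
  have "z \<in> W1 \<union> W2" if "z \<in> {0..<a}" for z
    using covered_mod_diameter[OF X(1) Y(1) X(2) Y(2) card, of z] that by (auto simp: W1_def W2_def)
  then have "{0..<a} \<subseteq> W1 \<union> W2"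
    by blast
  then have "card {0..<a} \<le> card (W1 \<union> W2)"
    by (intro card_mono) (simp_all add: W1_def W2_def)
  then have c1: "a \<le> int (card (W1 \<union> W2))"
    using a by simp
  have "(Y \<inter> {0..<a}) \<union> Z \<subseteq> W1 \<inter> W2"
    using Z YS by (auto simp: W1_def W2_def)
  then have "card ((Y \<inter> {0..<a}) \<union> Z) \<le> card (W1 \<inter> W2)"
    by (intro card_mono) (auto simp: W1_def W2_def)
  moreover have "card ((Y \<inter> {0..<a}) \<union> Z) = card (Y \<inter> {0..<a}) + card Z"
    using Z(1) fin by (intro card_Un_disjoint) auto
  ultimately have c2: "card (Y \<inter> {0..<a}) + card Z \<le> card (W1 \<inter> W2)"
    by simp
  have c3: "card Y \<le> card (Y \<inter> {0..<a}) + card W3"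
  proof -
    have "Y \<subseteq> (Y \<inter> {0..<a}) \<union> W3"
      using Y YS by (force simp: W3_def)
    then have "card Y \<le> card ((Y \<inter> {0..<a}) \<union> W3)"
      using fin by (intro card_mono) (auto simp: W3_def)
    then show ?thesis
      using card_Un_le[of "Y \<inter> {0..<a}" W3] by linarith
  qed
  have c4: "card W1 + card W2 = card (W1 \<union> W2) + card (W1 \<inter> W2)"
    by (intro card_Un_Int) (auto simp: W1_def W2_def)
  have "card W1 + (card W2 + card W3) = card (W1 \<union> (\<lambda>z. z + a) ` (W2 \<union> W3))"
  proof -
    have "card ((\<lambda>z. z + a) ` (W2 \<union> W3)) = card W2 + card W3"
      by (subst card_image, simp, subst card_Un_disjoint) (simp_all add: W2_def W3_def, auto)
    then show ?thesis
      by (subst card_Un_disjoint) (auto simp: W1_def W2_def W3_def)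
  qed
  also have "\<dots> \<le> card (X + Y)"
    using fin by (intro card_mono finite_set_plus) (auto simp: W1_def W2_def W3_def)
  finally show ?thesis
    using c1 c2 c3 c4 by linarith
qed

text \<open>Let \<open>x\<close> be the last hole up to \<open>a\<close> and \<open>y + a\<close>
  the first hole from \<open>a\<close> on. If \<open>y < x\<close>, the walk \<open>excess\<close>
  falls from at least \<open>t + 1\<close> to at most 0 between them, and each level from 1 to
  \<open>t - 1\<close> supplies a point outside \<open>Y\<close> whose class modulo \<open>a\<close>
  is met twice; this makes the sumset as large as \<open>small\<close> forbids. So
  \<open>x < y\<close>, everything strictly between \<open>x\<close> and \<open>y + a\<close> is
  covered, and the rise of the walk from \<open>x\<close> to \<open>y - 1\<close> makes this stretch
  long.\<close>

lemma sumset_long_interval: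
  fixes X Y :: "int set"
  assumes X: "X \<subseteq> {0..a}" "0 \<in> X" "a \<in> X" and Y: "Y \<subseteq> {0..a}" "0 \<in> Y"
    and card: "a + 3 \<le> int (card X) + int (card Y)"
    and small: "int (card (X + Y)) < int (card X) + 2 * int (card Y) - 3"
  obtains l where "{l..<l + int (card X) + int (card Y) - 1} \<subseteq> X + Y"
proof -
  define t where "t = int (card X) + int (card Y) - a - 2"
  have t: "1 \<le> t"
    using card by (simp add: t_def)
  have a: "0 \<le> a"
    using X by auto
  have sub: "X + Y \<subseteq> {0..2 * a}"
    using X Y by (fastforce elim!: set_plus_elim)
  \<comment> \<open>The points \<open>- 1\<close> and \<open>a + 1\<close> serve as sentinels: they
    are always holes, so the extremal holes below exist.\<close>
  define H1 where "H1 = {-1..a} \<inter> {z. z \<notin> X + Y}"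
  define H2 where "H2 = {0..a + 1} \<inter> {z. z + a \<notin> X + Y}"
  have fin: "finite H1" "finite H2"
    by (auto simp: H1_def H2_def)
  have ne: "- 1 \<in> H1" "a + 1 \<in> H2"
    using sub a by (auto simp: H1_def H2_def)
  define x where "x = Max H1"
  define y where "y = Min H2"
  have "x \<in> H1" "y \<in> H2"
    unfolding x_def y_def using fin ne by (auto intro!: Max_in Min_in)
  then have x: "- 1 \<le> x" "x \<le> a" "x \<notin> X + Y" and y: "0 \<le> y" "y \<le> a + 1" "y + a \<notin> X + Y"
    by (auto simp: H1_def H2_def)
  have xmax: "z \<in> X + Y" if "x < z" "z \<le> a" for z
  proof (rule ccontr)
    assume "z \<notin> X + Y"
    then have "z \<le> x"
      unfolding x_def using fin that x by (intro Max_ge) (auto simp: H1_def)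
    then show False using that by simp
  qed
  have ymin: "z + a \<in> X + Y" if "0 \<le> z" "z < y" for z
  proof (rule ccontr)
    assume "z + a \<notin> X + Y"
    then have "y \<le> z"
      unfolding y_def using fin that y by (intro Min_le) (auto simp: H2_def)
    then show False using that by simp
  qed
  have gx: "excess X Y x \<le> 0"
  proof (cases "x = - 1")
    case False
    then show ?thesis
      using mem_sumset_if_excess_pos[of x X Y] x by fastforce
  qed simp
  have gy: "t + 1 \<le> excess X Y (y - 1)"
    using mem_sumset_if_excess_small[OF X(1) Y(1) y(1,2)] y(3) by (force simp: t_def)
  have "\<not> y < x"
  proof
    assume yx: "y < x"
    have "x \<noteq> a"
      using set_plus_intro[OF X(3) Y(2)] x by auto
    define Z where "Z = {0..<a} \<inter> {z. z \<notin> Y \<and> z \<in> X + Y \<and> z + a \<in> X + Y}"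
    have finZ: "finite Z"
      by (auto simp: Z_def)
    have "{1..t - 1} \<subseteq> excess X Y ` Z"
    proof
      fix j assume j: "j \<in> {1..t - 1}"
      \<comment> \<open>At \<open>Min D\<close> the walk drops from \<open>j + 1\<close> to
        \<open>j\<close>, so this point misses both sets. As \<open>j\<close> is positive and
        \<open>j + 1\<close> is at most \<open>t\<close>, both membership criteria apply
        there.\<close>
      define D where "D = {y..x} \<inter> {z. excess X Y z \<le> j}"
      have "x \<in> D" "finite D"
        using yx gx j by (auto simp: D_def)
      then have "Min D \<in> D"
        by (auto intro!: Min_in)
      then have z: "y \<le> Min D" "Min D \<le> x" "excess X Y (Min D) \<le> j"
        by (auto simp: D_def)
      have z1: "j + 1 \<le> excess X Y (Min D - 1)"
      proof (rule ccontr)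
        assume c: "\<not> j + 1 \<le> excess X Y (Min D - 1)"
        then have "Min D \<noteq> y"
          using gy j by auto
        then have "Min D - 1 \<in> D"
          using c z by (auto simp: D_def)
        then show False
          using Min_le[OF \<open>finite D\<close>, of "Min D - 1"] by simp
      qed
      have "Min D \<notin> Y" and ej: "excess X Y (Min D) = j" "excess X Y (Min D - 1) = j + 1"
        using z z1 y(1) excess_step[of "Min D" X Y] by (auto split: if_splits)
      moreover have "Min D \<in> X + Y"
        using z y j ej by (intro mem_sumset_if_excess_pos) auto
      moreover have "Min D + a \<in> X + Y"
        using z y x j ej by (intro mem_sumset_if_excess_small[OF X(1) Y(1)]) (auto simp: t_def)
      ultimately have "Min D \<in> Z"
        using z y x \<open>x \<noteq> a\<close> by (auto simp: Z_def)
      then show "j \<in> excess X Y ` Z"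
        using ej by auto
    qed
    then have "card {1..t - 1} \<le> card Z"
      using finZ by (meson surj_card_le)
    moreover have "a + int (card Y) + int (card Z) \<le> int (card (X + Y))"
      by (rule card_sumset_ge_diameter[OF X Y card]) (auto simp: Z_def)
    ultimately show False
      using small t by (simp add: t_def)
  qed
  moreover have "x \<noteq> y"
    using covered_mod_diameter[OF X(1) Y(1) X(2) Y(2) card] x y by auto
  ultimately have xy: "x \<le> y - 1"
    by simp
  have "t + 1 \<le> y - 1 - x"
    using excess_lipschitz[OF x(1) xy, of X Y] gx gy by simp
  then have "int (card X) + int (card Y) - 1 \<le> y + a - (x + 1)"
    by (simp add: t_def)
  moreover have "z \<in> X + Y" if "z \<in> {x + 1..<y + a}" for z
    using xmax[of z] ymin[of "z - a"] that by (cases "z \<le> a") auto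
  ultimately show ?thesis
    by (intro that[of "x + 1"]) force
qed

section \<open>Freiman's theorem\<close>

lemma sumset_translate:
  fixes X :: "int set"
  shows "((\<lambda>x. x + c) ` X) + ((\<lambda>x. x + c) ` X) = (\<lambda>x. x + 2 * c) ` (X + X)"
proof (intro equalityI subsetI)
  fix z assume "z \<in> ((\<lambda>x. x + c) ` X) + ((\<lambda>x. x + c) ` X)"
  then obtain x y where "x \<in> X" "y \<in> X" "z = (x + y) + 2 * c"
    by (fastforce elim!: set_plus_elim)
  then show "z \<in> (\<lambda>x. x + 2 * c) ` (X + X)"
    by (auto intro!: set_plus_intro)
next
  fix z assume "z \<in> (\<lambda>x. x + 2 * c) ` (X + X)"
  then obtain x y where xy: "x \<in> X" "y \<in> X" "z = x + y + 2 * c"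
    by (fastforce elim!: set_plus_elim)
  then have "(x + c) + (y + c) \<in> ((\<lambda>x. x + c) ` X) + ((\<lambda>x. x + c) ` X)"
    by (intro set_plus_intro) auto
  then show "z \<in> ((\<lambda>x. x + c) ` X) + ((\<lambda>x. x + c) ` X)"
    using xy by (simp add: algebra_simps)
qed

text \<open>In Freiman's theorem a sparse set \<open>A = P \<union> C\<close> will be cut at the first \<open>z\<close> for which at most
  half of \<open>{0..z}\<close> lies in \<open>A\<close>. The next three lemmas bound the sums outside \<open>P + P\<close>: when \<open>C\<close> lies in
  a single residue class, when \<open>C\<close> itself satisfies the theorem, and when \<open>C + C\<close> contains a long
  interval.\<close>

lemma card_PC_residues:
  fixes P C :: "int set"
  assumes fin: "finite P" "finite C" and C: "C \<noteq> {}" and lt: "\<And>p c. p \<in> P \<Longrightarrow> c \<in> C \<Longrightarrow> p < c"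
    and d: "\<And>c. c \<in> C \<Longrightarrow> d dvd c - Min C" and p: "p \<in> P" "\<not> d dvd p - Min C"
  shows "card P + 3 * card C \<le> card ((P + C) \<union> (C + C)) + 2"
proof -
  \<comment> \<open>Three disjoint families of sums: \<open>Q + C\<close> leaves the class of
    \<open>2 * Min C\<close> modulo \<open>d\<close>, while \<open>R\<close> and
    \<open>C + C\<close> stay in it and \<open>R\<close> lies below \<open>C + C\<close>. They have
    at least \<open>card Q + card C - 1\<close>, \<open>card P - card Q\<close> and
    \<open>2 * card C - 1\<close> elements.\<close>
  define Q where "Q = {p \<in> P. \<not> d dvd p - Min C}"
  define R where "R = (\<lambda>p. p + Min C) ` (P - Q)"
  have mC: "Min C \<in> C"
    using fin C by simp
  have Q: "Q \<subseteq> P" "Q \<noteq> {}" "finite Q"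
    using p fin by (auto simp: Q_def)
  have modC: "d dvd z - 2 * Min C" if "z \<in> C + C" for z
  proof -
    from that obtain c c' where "c \<in> C" "c' \<in> C" "z = c + c'"
      by (auto elim!: set_plus_elim)
    then have "d dvd (c - Min C) + (c' - Min C)"
      by (intro dvd_add d)
    moreover have "z - 2 * Min C = (c - Min C) + (c' - Min C)"
      using \<open>z = c + c'\<close> by simp
    ultimately show ?thesis by argo
  qed
  have modQ: "\<not> d dvd z - 2 * Min C" if "z \<in> Q + C" for z
  proof -
    from that obtain q c where qc: "q \<in> Q" "c \<in> C" "z = q + c"
      by (auto elim!: set_plus_elim)
    then have "z - 2 * Min C = (q - Min C) + (c - Min C)"
      by simp
    then show ?thesis
      using d[OF qc(2)] qc(1) by (simp only: dvd_add_left_iff) (simp add: Q_def)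
  qed
  have modR: "d dvd z - 2 * Min C" if "z \<in> R" for z
    using that by (auto simp: R_def Q_def algebra_simps)
  have "R \<inter> (C + C) = {}"
  proof -
    have "z \<notin> R" if "z \<in> C + C" for z
    proof
      from that obtain c c' where c: "c \<in> C" "c' \<in> C" "z = c + c'"
        by (auto elim!: set_plus_elim)
      assume "z \<in> R"
      then obtain p where "p \<in> P" "z = p + Min C"
        by (auto simp: R_def)
      moreover from this have "p < Min C"
        using lt mC by auto
      moreover have "Min C \<le> c" "Min C \<le> c'"
        using c fin by auto
      ultimately show False
        using c by simp
    qed
    then show ?thesis by blast
  qed
  then have "card ((Q + C) \<union> (R \<union> (C + C))) = card (Q + C) + (card R + card (C + C))"
  proof (subst card_Un_disjoint)
    show "(Q + C) \<inter> (R \<union> (C + C)) = {}"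
      using modC modQ modR by blast
    show "card (Q + C) + card (R \<union> (C + C)) = card (Q + C) + (card R + card (C + C))"
      using \<open>R \<inter> (C + C) = {}\<close> fin by (subst card_Un_disjoint) (auto simp: R_def intro: finite_set_plus)
  qed (use fin Q in \<open>auto simp: R_def intro: finite_set_plus\<close>)
  moreover have "(Q + C) \<union> (R \<union> (C + C)) \<subseteq> (P + C) \<union> (C + C)"
    using Q(1) mC set_plus_mono2[OF Q(1) order_refl] by (auto simp: R_def)
  then have "card ((Q + C) \<union> (R \<union> (C + C))) \<le> card ((P + C) \<union> (C + C))"
    using fin by (intro card_mono) (auto intro: finite_set_plus)
  moreover have "card R + card Q = card P"
    using Q fin card_mono[OF fin(1) Q(1)]
    by (simp add: R_def card_image inj_on_def card_Diff_subset)
  ultimately show ?thesis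
    using card_sumset_ge[OF Q(3) fin(2) Q(2) C] card_sumset_ge[OF fin(2) fin(2) C C] by linarith
qed

lemma PC_extra_element:
  fixes P C :: "int set"
  assumes fin: "finite P" "finite C" and P: "0 \<in> P" "P \<subseteq> {0..<z}" and C: "C \<subseteq> {z<..}"
    and two: "card C \<ge> 2" and i: "1 \<in> P \<or> P = {0}" "1 \<le> z"
    and gcd: "Gcd (P \<union> C) = 1"
  shows "\<not> P + C \<subseteq> (C + C) \<union> (\<lambda>p. p + Min C) ` P"
proof
  assume sub: "P + C \<subseteq> (C + C) \<union> (\<lambda>p. p + Min C) ` P"
  define m where "m = Min C"
  have "C \<noteq> {}" using two by auto
  then have mC: "m \<in> C" and mle: "\<And>c. c \<in> C \<Longrightarrow> m \<le> c"
    using fin by (auto simp: m_def)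
  have zm: "z < m"
    using mC C by auto
  show False
  proof (cases "P = {0}")
    case True
    \<comment> \<open>Under \<open>sub\<close>, an element of \<open>C\<close> other than
      \<open>m\<close> splits into two smaller elements of \<open>C\<close>, so everything is a
      multiple of \<open>m\<close>. This contradicts the greatest common divisor, because
      \<open>m\<close> exceeds 1.\<close>
    have "m dvd c" if "c \<in> C" for c
      using that
    proof (induction "nat c" arbitrary: c rule: less_induct)
      case less
      have "0 + c \<in> P + C"
        using less.prems P by (intro set_plus_intro) auto
      then have "c \<in> C + C \<or> c = m"
        using sub True by (auto simp: m_def)
      then show ?case
      proof
        assume "c \<in> C + C"
        then obtain x y where xy: "x \<in> C" "y \<in> C" "c = x + y"
          by (auto elim!: set_plus_elim)
        then have "0 < x" "0 < y"
          using mle[of x] mle[of y] zm i by auto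
        then show ?thesis
          using less.hyps[of x] less.hyps[of y] xy by auto
      qed simp
    qed
    then have "m dvd Gcd (P \<union> C)"
      using True by (intro Gcd_greatest) auto
    then show False
      using gcd zm i by auto
  next
    case False
    then have "1 \<in> P"
      using i by auto
    define q where "q = Max P"
    have qP: "q \<in> P" and qge: "\<And>p. p \<in> P \<Longrightarrow> p \<le> q"
      using fin P by (auto simp: q_def intro!: Max_in)
    have qz: "q < z"
      using qP P by auto
    define C' where "C' = C - {m}"
    have "card C' \<noteq> 0"
      using two mC fin by (simp add: C'_def card_Diff_singleton)
    then have "C' \<noteq> {}"
      by auto
    then have "Min C' \<in> C'"
      using fin by (intro Min_in) (simp_all add: C'_def)
    define s where "s = Min C' - m"
    have c2: "m + s \<in> C" "0 < s" "\<And>c. c \<in> C \<Longrightarrow> c \<noteq> m \<Longrightarrow> m + s \<le> c"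
    proof -
      have "Min C' \<in> C" "Min C' \<noteq> m"
        using \<open>Min C' \<in> C'\<close> by (simp_all add: C'_def)
      then show "m + s \<in> C" "0 < s"
        using mle[of "Min C'"] by (simp_all add: s_def)
      show "m + s \<le> c" if "c \<in> C" "c \<noteq> m" for c
        using that fin by (simp add: s_def) (simp add: C'_def)
    qed
    have CC: "w = 2 * m \<or> 2 * m + s \<le> w" if "w \<in> C + C" for w
    proof -
      from that obtain x y where xy: "x \<in> C" "y \<in> C" "w = x + y"
        by (auto elim!: set_plus_elim)
      then show ?thesis
        using c2(2) c2(3)[of x] c2(3)[of y] mle[of x] mle[of y] by fastforce
    qed
    \<comment> \<open>Here \<open>s\<close> is the gap between the two least elements of
      \<open>C\<close>. Since \<open>p + (m + s)\<close> is below \<open>2 * m + s\<close>, the only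
      sum in \<open>C + C\<close> that it can equal is \<open>2 * m\<close>. Hence \<open>P\<close>
      is closed under adding \<open>s\<close> until \<open>m\<close> is reached; with 0 and 1 in
      \<open>P\<close> this forces \<open>s = 1\<close> and puts \<open>m - 1\<close> into
      \<open>P\<close>, although \<open>P\<close> ends below \<open>z < m\<close>.\<close>
    have up: "p + s \<in> P \<or> p + s = m" if "p \<in> P" for p
    proof -
      have "p + (m + s) \<in> P + C"
        using that c2 by (intro set_plus_intro) auto
      then have "p + (m + s) \<in> C + C \<or> p + s \<in> P"
        using sub by (auto simp: m_def algebra_simps)
      moreover have "p < m"
        using qge[OF that] qz zm by simp
      ultimately show ?thesis
        using CC[of "p + (m + s)"] by auto
    qed
    then have qs: "q + s = m"
      using qge[of "q + s"] qP c2(2) by fastforce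
    have div: "s dvd q - p" if "p \<in> P" for p
      using that
    proof (induction "nat (q - p)" arbitrary: p rule: less_induct)
      case less
      show ?case
      proof (cases "p = q")
        case False
        then have "p + s \<in> P"
          using up[OF less.prems] qs by auto
        then have "s dvd q - (p + s)"
          using less.hyps[of "p + s"] c2(2) qge[of "p + s"] by auto
        then have "s dvd q - (p + s) + s"
          by (intro dvd_add) auto
        then show ?thesis by simp
      qed simp
    qed
    have "s dvd (q - 0) - (q - 1)"
      by (rule dvd_diff[OF div[OF P(1)] div[OF \<open>1 \<in> P\<close>]])
    then have "s = 1"
      using c2(2) by simp
    then show False
      using qs qz zm by simp
  qed
qed

lemma card_PC_interval:
  fixes P C :: "int set"
  assumes fin: "finite P" "finite C" and P: "0 \<in> P" "P \<subseteq> {0..<z}" and C: "C \<subseteq> {z<..a}" "a \<in> C"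
    and z: "z = 2 * int (card P) - 1"
    and a: "2 * int (card P) + 2 * int (card C) - 2 \<le> a"
    and I: "{l..<l + 2 * int (card C) - 1} \<subseteq> C + C"
  shows "card P + 3 * card C \<le> card ((P + C) \<union> (C + C)) + 2"
proof -
  define m where "m = Min C"
  have mC: "m \<in> C" and mle: "\<And>c. c \<in> C \<Longrightarrow> m \<le> c"
    using fin C(2) by (auto simp: m_def intro!: Min_in)
  have "C \<noteq> {}" using C(2) by auto
  then have card_pos: "0 < card C"
    using fin by auto
  define q where "q = Max P"
  have qP: "q \<in> P" and qge: "\<And>p. p \<in> P \<Longrightarrow> p \<le> q"
    using fin P by (auto simp: q_def intro!: Max_in)
  have qz: "q < z" and zm: "z < m"
    using qP P mC C by auto
  define w where "w = l + 2 * int (card C) - 2"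
  have I': "{l..w} \<subseteq> C + C"
    using I by (force simp: w_def)
  have "l \<in> C + C"
    using I card_pos by auto
  then obtain c c' where "c \<in> C" "c' \<in> C" "l = c + c'"
    by (auto elim!: set_plus_elim)
  then have l: "2 * m \<le> l"
    using mle[of c] mle[of c'] by simp
  \<comment> \<open>From below: the sums of \<open>P\<close> with the least element of
    \<open>C\<close>, then those of \<open>C\<close> with the largest element of \<open>P\<close>
    that stay under the interval, then the interval itself, then the sums with \<open>a\<close>
    beyond it.\<close>
  define T1 where "T1 = (\<lambda>p. p + m) ` P"
  define T2 where "T2 = (\<lambda>c. q + c) ` (C \<inter> {m<..<l - q})"
  define T3 where "T3 = {l..w}"
  define T4 where "T4 = (\<lambda>c. c + a) ` (C \<inter> {w - a<..})"
  have sub: "(T1 \<union> T2) \<union> (T3 \<union> T4) \<subseteq> (P + C) \<union> (C + C)"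
    using mC qP I' C(2) by (auto simp: T1_def T2_def T3_def T4_def intro!: set_plus_intro)
  have "card ((T1 \<union> T2) \<union> (T3 \<union> T4)) = card (T1 \<union> T2) + card (T3 \<union> T4)"
  proof (rule card_Un_disjoint)
    have "x < l" if "x \<in> T1 \<union> T2" for x
      using that qge qz zm l by (fastforce simp: T1_def T2_def)
    moreover have "l \<le> x" if "x \<in> T3 \<union> T4" for x
      using that card_pos by (auto simp: T3_def T4_def w_def)
    ultimately show "(T1 \<union> T2) \<inter> (T3 \<union> T4) = {}"
      by fastforce
  qed (use fin in \<open>auto simp: T1_def T2_def T3_def T4_def\<close>)
  also have "card (T1 \<union> T2) = card T1 + card T2"
    using fin qge by (intro card_Un_disjoint) (fastforce simp: T1_def T2_def)+
  also have "card (T3 \<union> T4) = card T3 + card T4"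
    using fin by (intro card_Un_disjoint) (auto simp: T3_def T4_def)
  also have "card T1 = card P"
    by (simp add: T1_def card_image inj_on_def)
  also have "card T2 = card (C \<inter> {m<..<l - q})"
    by (simp add: T2_def card_image inj_on_def)
  also have "card T4 = card (C \<inter> {w - a<..})"
    by (simp add: T4_def card_image inj_on_def)
  finally have eq: "card ((T1 \<union> T2) \<union> (T3 \<union> T4))
      = card P + card (C \<inter> {m<..<l - q}) + (card T3 + card (C \<inter> {w - a<..}))" .
  have le: "card ((T1 \<union> T2) \<union> (T3 \<union> T4)) \<le> card ((P + C) \<union> (C + C))"
    using sub fin by (intro card_mono) (auto intro: finite_set_plus)
  have T3: "int (card T3) = 2 * int (card C) - 1"
    using card_pos by (simp add: T3_def w_def)
  \<comment> \<open>The elements of \<open>C\<close> used by neither \<open>T2\<close> nor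
    \<open>T4\<close>. There are none: \<open>w - l\<close> is \<open>2 * card C - 2\<close> and
    \<open>q\<close> is at most \<open>2 * card P - 2\<close>, so \<open>w - a < l - q\<close> by
    the assumption on \<open>a\<close>. Only \<open>m\<close> is lost.\<close>
  define G where "G = C \<inter> {l - q..w - a}"
  have "C \<subseteq> insert m ((C \<inter> {m<..<l - q}) \<union> (C \<inter> {w - a<..}) \<union> G)"
    using mle by (fastforce simp: G_def)
  then have "card C \<le> card (insert m ((C \<inter> {m<..<l - q}) \<union> (C \<inter> {w - a<..}) \<union> G))"
    using fin by (intro card_mono) (auto simp: G_def)
  also have "\<dots> \<le> Suc (card ((C \<inter> {m<..<l - q}) \<union> (C \<inter> {w - a<..}) \<union> G))"
    using fin by (intro card_insert_le_m1 card_insert_le) (auto simp: card_insert_if)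
  also have "\<dots> \<le> Suc (card (C \<inter> {m<..<l - q}) + card (C \<inter> {w - a<..}) + card G)"
    using card_Un_le[of "(C \<inter> {m<..<l - q}) \<union> (C \<inter> {w - a<..})" G]
      card_Un_le[of "C \<inter> {m<..<l - q}" "C \<inter> {w - a<..}"] by linarith
  finally have cC: "card C \<le> Suc (card (C \<inter> {m<..<l - q}) + card (C \<inter> {w - a<..}) + card G)" .
  have "card G = 0 \<or> int (card G) \<le> w - a - (l - q) + 1"
  proof (cases "l - q \<le> w - a")
    case True
    have "card G \<le> card {l - q..w - a}"
      by (intro card_mono) (auto simp: G_def)
    then show ?thesis
      using True by (simp add: le_nat_iff)
  qed (simp add: G_def)
  then show ?thesis
    using eq le T3 cC a z qz by (auto simp: w_def)
qed

text \<open>Strong induction on the size. The cut falls at \<open>z = 2 * card P - 1\<close>, and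
  \<open>P + P\<close> covers \<open>{0..<z}\<close>, so it remains to find
  \<open>card P + 3 * card C - 2\<close> sums involving \<open>C\<close>, all of which exceed
  \<open>z\<close>. The induction hypothesis shows that a \<open>C\<close> of small doubling has
  small diameter, which is what produces an interval in \<open>C + C\<close>.\<close>

theorem Freiman_3k_minus_3:
  fixes A :: "int set"
  assumes "A \<subseteq> {0..a}" "0 \<in> A" "a \<in> A" "Gcd A = 1" "2 * int (card A) - 2 \<le> a"
  shows "3 * card A \<le> card (A + A) + 3"
  using assms
proof (induction "card A" arbitrary: A a rule: less_induct)
  case less
  note A = less.prems
  have finA: "finite A"
    using A(1) finite_subset by blast
  have a: "0 < a"
  proof (rule ccontr)
    assume "\<not> 0 < a"
    then have "A = {0}"
      using A(1,2) by auto
    then show False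
      using A(4) by simp
  qed
  define g where "g = excess A A"
  have g_eq: "g z = 2 * int (card (A \<inter> {0..z})) - (z + 1)" for z
    by (simp add: g_def excess_def)
  have "A \<inter> {0..a} = A" "A \<inter> {0..0} = {0}"
    using A by auto
  then have "g a \<le> 1" and g0: "g 0 = 1"
    using A(5) by (auto simp: g_eq)
  \<comment> \<open>The walk steps up at \<open>a\<close>, so it is already nonpositive before. This
    keeps \<open>a\<close> beyond the cut and \<open>C\<close> nonempty.\<close>
  then have "g (a - 1) \<le> 0"
    using excess_step[of a A A] A(3) a by (simp add: g_def)
  define H where "H = {0..a - 1} \<inter> {z. g z \<le> 0}"
  have "finite H" "a - 1 \<in> H"
    using \<open>g (a - 1) \<le> 0\<close> a by (auto simp: H_def)
  define z where "z = Min H"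
  have "z \<in> H"
    unfolding z_def using \<open>finite H\<close> \<open>a - 1 \<in> H\<close> by (intro Min_in) auto
  then have z: "0 \<le> z" "z < a" "g z \<le> 0"
    by (auto simp: H_def)
  have zmin: "0 < g y" if "0 \<le> y" "y < z" for y
  proof (rule ccontr)
    assume "\<not> 0 < g y"
    then have "y \<in> H"
      using that z by (auto simp: H_def)
    then show False
      using Min_le[OF \<open>finite H\<close>, of y] that by (simp add: z_def)
  qed
  have "z \<noteq> 0"
    using g0 z(3) by auto
  then have z1: "1 \<le> z" "0 < g (z - 1)"
    using z(1) zmin[of "z - 1"] by auto
  have gz: "g z = 0" "z \<notin> A"
    using excess_step[of z A A] z z1 by (auto simp: g_def split: if_splits)
  define P where "P = A \<inter> {0..z}"
  define C where "C = A - P"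
  have zP: "z = 2 * int (card P) - 1"
    using gz(1) by (simp add: g_eq P_def)
  have P: "0 \<in> P" "P \<subseteq> {0..<z}"
    using A(2) z gz(2) by (auto simp: P_def order_le_less)
  have C: "C \<subseteq> {z<..a}" "a \<in> C"
    using A(1,3) z by (auto simp: C_def P_def)
  have fin: "finite P" "finite C"
    using finA by (auto simp: P_def C_def)
  have AU: "A = P \<union> C"
    by (auto simp: P_def C_def)
  have "P \<inter> C = {}"
    by (auto simp: C_def)
  then have cardA: "card A = card P + card C"
    using AU fin by (metis card_Un_disjoint)
  have lt: "p < c" if "p \<in> P" "c \<in> C" for p c
    using that P C by fastforce
  define m where "m = Min C"
  have "C \<noteq> {}"
    using C by auto
  then have mC: "m \<in> C" and mle: "\<And>c. c \<in> C \<Longrightarrow> m \<le> c"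
    using fin by (auto simp: m_def)
  have one: "1 \<in> P \<or> P = {0}"
  proof (cases "z = 1")
    case True
    then have "P \<subseteq> {0}"
      using P(2) by auto
    then show ?thesis
      using P(1) by auto
  next
    case False
    then have "0 < g 1"
      using z1 by (intro zmin) auto
    then have "1 \<in> A"
      using excess_step[of 1 A A] g0 by (auto simp: g_def split: if_splits)
    then show ?thesis
      using z1 by (auto simp: P_def)
  qed
  have low: "{0..<z} \<subseteq> P + P"
  proof
    fix y assume y: "y \<in> {0..<z}"
    have "0 + y \<in> (A \<inter> {0..y}) + (A \<inter> {0..y})"
      using zmin[of y] y by (intro midpoint_in_sumset) (auto simp: g_eq)
    moreover have "A \<inter> {0..y} \<subseteq> P"
      using y by (auto simp: P_def)
    ultimately show "y \<in> P + P"
      using set_plus_mono2[of "A \<inter> {0..y}" P "A \<inter> {0..y}" P] by auto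
  qed
  have finS: "finite ((P + C) \<union> (C + C))"
    using fin by (auto intro: finite_set_plus)
  have "{0..<z} \<union> ((P + C) \<union> (C + C)) \<subseteq> A + A"
    using low set_plus_mono2[of P A P A] set_plus_mono2[of P A C A] set_plus_mono2[of C A C A] AU
    by blast
  then have "card ({0..<z} \<union> ((P + C) \<union> (C + C))) \<le> card (A + A)"
    using finA by (intro card_mono finite_set_plus) auto
  moreover have "z < w" if "w \<in> (P + C) \<union> (C + C)" for w
  proof -
    from that obtain b c where "b \<in> A" "c \<in> C" "w = b + c"
      using AU by (auto elim!: set_plus_elim)
    then show ?thesis
      using A(1) C(1) by fastforce
  qed
  then have "{0..<z} \<inter> ((P + C) \<union> (C + C)) = {}"
    by fastforce
  then have "card ({0..<z} \<union> ((P + C) \<union> (C + C))) = card {0..<z} + card ((P + C) \<union> (C + C))"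
    using finS by (intro card_Un_disjoint) auto
  moreover have "int (card {0..<z}) = z"
    using z by simp
  ultimately have lower: "z + int (card ((P + C) \<union> (C + C))) \<le> int (card (A + A))"
    by linarith
  have "card P + 3 * card C \<le> card ((P + C) \<union> (C + C)) + 2"
  proof -
    define C0 where "C0 = (\<lambda>c. c - m) ` C"
    have C0: "C0 \<subseteq> {0..a - m}" "0 \<in> C0" "a - m \<in> C0"
      using C mC mle by (force simp: C0_def)+
    have CC: "C + C = (\<lambda>z. z + 2 * m) ` (C0 + C0)"
      using sumset_translate[of m C0] by (simp add: C0_def image_image)
    have cardC0: "card C0 = card C" "card (C0 + C0) = card (C + C)"
      by (simp_all add: C0_def CC card_image inj_on_def)
    have dvdC: "Gcd C0 dvd c - Min C" if "c \<in> C" for c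
      using that by (auto simp: C0_def m_def intro!: Gcd_dvd)
    \<comment> \<open>The first case includes \<open>Gcd C0 = 0\<close>, when \<open>C\<close> is a
      singleton and congruence is equality.\<close>
    consider "Gcd C0 \<noteq> 1" | "Gcd C0 = 1" "3 * card C \<le> card (C + C) + 3"
      | "Gcd C0 = 1" "card (C + C) + 3 < 3 * card C"
      by linarith
    then show ?thesis
    proof cases
      case 1
      have "\<exists>p\<in>P. \<not> Gcd C0 dvd p - m"
      proof (rule ccontr)
        assume "\<not> ?thesis"
        then have dP: "Gcd C0 dvd p - m" if "p \<in> P" for p
          using that by blast
        have "Gcd C0 dvd b" if "b \<in> A" for b
        proof -
          have "Gcd C0 dvd b - m"
            using that dP dvdC AU by (auto simp: m_def)
          then have "Gcd C0 dvd (b - m) - (0 - m)"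
            using dP[OF P(1)] by (rule dvd_diff)
          then show ?thesis by simp
        qed
        then have "Gcd C0 dvd Gcd A"
          by (intro Gcd_greatest)
        then show False
          using A(4) 1 by (simp add: zdvd1_eq)
      qed
      then obtain p where "p \<in> P" "\<not> Gcd C0 dvd p - Min C"
        by (auto simp: m_def)
      then show ?thesis
        using fin \<open>C \<noteq> {}\<close> lt dvdC by (intro card_PC_residues[where d = "Gcd C0"])
    next
      case 2
      have "card C \<noteq> 1"
      proof
        assume "card C = 1"
        then obtain c where "C0 = {c}"
          using cardC0(1) by (auto simp: card_1_singleton_iff)
        then have "C0 = {0}"
          using C0(2) by auto
        then show False
          using 2(1) by simp
      qed
      moreover have "card C \<noteq> 0"
        using \<open>C \<noteq> {}\<close> fin by simp
      ultimately have "2 \<le> card C"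
        by simp
      let ?T = "(C + C) \<union> (\<lambda>p. p + Min C) ` P"
      have "?T \<subset> (P + C) \<union> (C + C)"
      proof -
        have "\<not> P + C \<subseteq> ?T"
          using A(4) AU P C one z1 \<open>2 \<le> card C\<close> fin by (intro PC_extra_element[where z = z]) auto
        moreover have "?T \<subseteq> (P + C) \<union> (C + C)"
          using mC by (auto simp: m_def)
        ultimately show ?thesis by blast
      qed
      then have "card ?T < card ((P + C) \<union> (C + C))"
        using finS by (rule psubset_card_mono[rotated])
      moreover have "card ?T = card (C + C) + card P"
      proof (subst card_Un_disjoint)
        have "p + m < c + c'" if "p \<in> P" "c \<in> C" "c' \<in> C" for p c c'
          using lt[OF that(1) mC] mle[OF that(2)] mle[OF that(3)] by simp
        then show "(C + C) \<inter> (\<lambda>p. p + Min C) ` P = {}"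
          by (force elim!: set_plus_elim simp: m_def)
      qed (use fin in \<open>auto simp: card_image inj_on_def intro: finite_set_plus\<close>)
      ultimately show ?thesis
        using 2(2) by linarith
    next
      case 3
      have "a - m < 2 * int (card C0) - 2"
      proof (rule ccontr)
        assume "\<not> ?thesis"
        moreover have "card C0 < card A"
          using cardA P fin cardC0 by (auto simp: card_gt_0_iff)
        ultimately have "3 * card C0 \<le> card (C0 + C0) + 3"
          using less.hyps[of C0 "a - m"] C0 3(1) by linarith
        then show False
          using 3(2) cardC0 by simp
      qed
      then have "(a - m) + 3 \<le> int (card C0) + int (card C0)"
        "int (card (C0 + C0)) < int (card C0) + 2 * int (card C0) - 3"
        using 3(2) cardC0 by linarith+
      then obtain l where l: "{l..<l + int (card C0) + int (card C0) - 1} \<subseteq> C0 + C0"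
        by (rule sumset_long_interval[OF C0 C0(1,2)])
      show ?thesis
      proof (rule card_PC_interval[OF fin P C zP])
        show "2 * int (card P) + 2 * int (card C) - 2 \<le> a"
          using A(5) cardA by simp
        show "{l + 2 * m..<(l + 2 * m) + 2 * int (card C) - 1} \<subseteq> C + C"
        proof
          fix x assume "x \<in> {l + 2 * m..<(l + 2 * m) + 2 * int (card C) - 1}"
          then have "x - 2 * m \<in> C0 + C0"
            using l cardC0 by auto
          then have "(x - 2 * m) + 2 * m \<in> C + C"
            unfolding CC by (rule imageI)
          then show "x \<in> C + C" by simp
        qed
      qed
    qed
  qed
  then show ?case
    using lower zP cardA by linarith
qed

corollary Freiman_3k_minus_4:
  fixes A :: "int set"
  assumes A: "A \<subseteq> {0..a}" "0 \<in> A" "a \<in> A" "Gcd A = 1" and small: "card (A + A) + 4 \<le> 3 * card A"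
  shows "a + int (card A) \<le> int (card (A + A))"
    and "\<exists>l. {l..<l + 2 * int (card A) - 1} \<subseteq> A + A"
proof -
  have "a + 3 \<le> int (card A) + int (card A)"
    using Freiman_3k_minus_3[OF A] small by linarith
  note * = A(1-3,1,2) this
  show "a + int (card A) \<le> int (card (A + A))"
    using card_sumset_ge_diameter[OF *, of "{}"] by simp
  have "int (card (A + A)) < int (card A) + 2 * int (card A) - 3"
    using small by linarith
  then obtain l where "{l..<l + int (card A) + int (card A) - 1} \<subseteq> A + A"
    by (rule sumset_long_interval[OF *])
  then show "\<exists>l. {l..<l + 2 * int (card A) - 1} \<subseteq> A + A"
    by (metis mult_2 add.assoc)
qed

section \<open>Affine images modulo a prime\<close>

text \<open>\<open>B\<close> is dense in its interval, so it contains pairs at every distance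
  \<open>j\<close> up to \<open>4 * N - p - 2\<close>. Their images differ by \<open>j * m\<close>
  without wrap-around and lie in \<open>{0..L}\<close>, whence \<open>j * m \<le> L\<close>. For the
  largest \<open>j\<close> and \<open>m\<close> at least 2 this means
  \<open>10 * N \<le> 3 * p + 4\<close>, just what the last hypothesis excludes.\<close>

lemma affine_small_multiplier_contradiction:
  fixes B :: "int set" and p w m l :: int
  defines "N \<equiv> int (card B)"
  assumes B: "B \<subseteq> {0..l}" and l: "l \<le> p - 2 * N"
    and img: "\<And>b. b \<in> B \<Longrightarrow> (m * b + w) mod p \<le> p - 2 * N"
    and m: "2 \<le> m" "2 * m < p" and cop: "coprime m p" and N: "3 * p + 5 \<le> 10 * N"
  shows False
proof -
  define L where "L = p - 2 * N"
  define f where "f = (\<lambda>b. (m * b + w) mod p)"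
  have p: "0 < p" using m by simp
  have finB: "finite B"
    using B finite_subset by blast
  have f: "0 \<le> f b" "f b < p" for b
    using p by (auto simp: f_def)
  have fL: "f b \<le> L" if "b \<in> B" for b
    using img that by (auto simp: f_def L_def)
  have N0: "0 < N" using N p by simp
  then obtain b0 where "b0 \<in> B"
    using finB by (auto simp: N_def card_gt_0_iff)
  then have l0: "0 \<le> l" "0 \<le> L"
    using B f(1)[of b0] fL by force+
  have many: "2 * N - l - j - 1 \<le> int (card (B \<inter> {b. b + j \<in> B}))" if "0 \<le> j" for j
  proof -
    define B' where "B' = (\<lambda>b. b - j) ` B"
    have "card (B \<union> B') + card (B \<inter> B') = card B + card B'"
      using finB card_Un_Int[of B B'] by (simp add: B'_def)
    moreover have "card B' = card B"
      by (simp add: B'_def card_image inj_on_def)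
    moreover have "card (B \<union> B') \<le> card {- j..l}"
      using B that by (intro card_mono) (force simp: B'_def)+
    moreover have "B \<inter> B' = B \<inter> {b. b + j \<in> B}"
      by (force simp: B'_def)
    ultimately show ?thesis
      using that l0 by (simp add: N_def)
  qed
  have inj: "inj_on f B"
  proof (rule inj_onI)
    fix b c assume bc: "b \<in> B" "c \<in> B" "f b = f c"
    then have "[m * b + w = m * c + w] (mod p)"
      by (simp add: f_def cong_def)
    then have "[b = c] (mod p)"
      using cop by (simp add: cong_add_rcancel cong_mult_lcancel)
    moreover have "b < p" "c < p" "0 \<le> b" "0 \<le> c"
      using bc B l N0 by force+
    ultimately show "b = c"
      by (simp add: cong_def)
  qed
  have f_step: "[f (b + j) = f b + m * j] (mod p)" for b j
  proof -
    have "[f (b + j) = m * (b + j) + w] (mod p)" "[f b = m * b + w] (mod p)"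
      by (simp_all add: f_def cong_def)
    then have "[f (b + j) - f b = (m * (b + j) + w) - (m * b + w)] (mod p)"
      by (rule cong_diff)
    then have "[(f (b + j) - f b) + f b = ((m * (b + j) + w) - (m * b + w)) + f b] (mod p)"
      by (rule cong_add[OF _ cong_refl])
    then show ?thesis
      by (simp add: algebra_simps)
  qed
  define B1 where "B1 = B \<inter> {b. b + 1 \<in> B}"
  have "f b \<le> L - m" if "b \<in> B1" for b
  proof -
    have "b \<in> B" "b + 1 \<in> B"
      using that by (auto simp: B1_def)
    moreover have "f b + m < p"
      using fL[OF \<open>b \<in> B\<close>] m N p by (simp add: L_def)
    then have "f (b + 1) = f b + m"
      using f_step[of b 1] f m by (simp add: cong_def)
    ultimately show ?thesis
      using fL[of "b + 1"] by simp
  qed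
  then have "f ` B1 \<subseteq> {0..L - m}"
    using f by auto
  then have "card (f ` B1) \<le> card {0..L - m}"
    by (intro card_mono) auto
  moreover have "card (f ` B1) = card B1"
    using inj by (intro card_image) (auto simp: B1_def inj_on_def)
  ultimately have "int (card B1) \<le> max 0 (L - m + 1)"
    by simp
  \<comment> \<open>Rewritten as \<open>L + (L + m) < p\<close>: a value up to \<open>L\<close>
    shifted by up to \<open>L + m\<close> does not wrap around. This drives the induction for
    \<open>mult\<close>.\<close>
  then have m_small: "m < p - 2 * L"
    using many[of 1] l N p m by (simp add: B1_def L_def)
  have mult: "j * m \<le> L" if "0 \<le> j" "j \<le> 4 * N - p - 2" for j
    using that
  proof (induction j rule: int_ge_induct)
    case base
    then show ?case using l0 by simp
  next
    case (step j)
    have "0 < int (card (B \<inter> {b. b + (j + 1) \<in> B}))"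
      using many[of "j + 1"] step l by simp
    then obtain b where b: "b \<in> B" "b + (j + 1) \<in> B"
      by (auto simp: card_gt_0_iff)
    have "j * m \<le> L"
      using step by simp
    then have less: "(j + 1) * m < p - L"
      using m_small by (simp add: algebra_simps)
    have "f b + (j + 1) * m < p"
      using less fL[OF b(1)] by simp
    moreover have "0 \<le> (j + 1) * m"
      using step m by simp
    ultimately have "f (b + (j + 1)) = f b + (j + 1) * m"
      using f_step[of b "j + 1"] f
      by (simp add: cong_def mult.commute)
    then show ?case
      using fL[OF b(2)] f(1)[of b] by simp
  qed
  have "(4 * N - p - 2) * m \<le> L"
    using mult[of "4 * N - p - 2"] N p by simp
  moreover have "(4 * N - p - 2) * 2 \<le> (4 * N - p - 2) * m"
    using m N p by (intro mult_left_mono) auto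
  ultimately show False
    using N by (simp add: L_def)
qed

lemma coprime_prime_int_less:
  fixes p x :: int
  assumes "prime p" "0 < x" "x < p"
  shows "coprime x p"
  using assms by (meson coprime_commute prime_imp_coprime zdvd_not_zless)

text \<open>Reflecting \<open>B\<close> in its interval replaces \<open>m\<close> by
  \<open>p - m\<close>, and one of the two is below \<open>p / 2\<close>.\<close>

lemma affine_multiplier_contradiction:
  fixes B :: "int set" and p w m l :: int
  assumes "prime p" and B: "B \<subseteq> {0..l}" and l: "l \<le> p - 2 * int (card B)"
    and img: "\<And>b. b \<in> B \<Longrightarrow> (m * b + w) mod p \<le> p - 2 * int (card B)"
    and m: "2 \<le> m" "m \<le> p - 2" and N: "3 * p + 5 \<le> 10 * int (card B)"
  shows False
proof -
  note cop = coprime_prime_int_less[OF \<open>prime p\<close>]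
  have "2 * m \<noteq> p"
  proof
    assume "2 * m = p"
    then have "m dvd p" by auto
    moreover have "0 \<le> m"
      using m by simp
    ultimately have "m = 1 \<or> m = p"
      using \<open>prime p\<close> unfolding prime_int_iff by blast
    then show False
      using m by simp
  qed
  then consider "2 * m < p" | "p < 2 * m"
    by linarith
  then show False
  proof cases
    case 1
    then show False
      using affine_small_multiplier_contradiction[OF B l img m(1)] cop N m by auto
  next
    case 2
    define B' where "B' = (\<lambda>b. l - b) ` B"
    have card: "card B' = card B"
      by (simp add: B'_def card_image inj_on_def)
    have "((p - m) * b + (w + m * l)) mod p \<le> p - 2 * int (card B')" if "b \<in> B'" for b
    proof -
      have "(p - m) * b + (w + m * l) = (m * (l - b) + w) + b * p"
        by (simp add: algebra_simps)
      then have "((p - m) * b + (w + m * l)) mod p = (m * (l - b) + w) mod p"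
        by (simp only: mod_mult_self1)
      moreover have "l - b \<in> B"
        using that by (auto simp: B'_def)
      ultimately show ?thesis
        using img[of "l - b"] card by simp
    qed
    moreover have "B' \<subseteq> {0..l}"
      using B by (auto simp: B'_def)
    ultimately show False
      using affine_small_multiplier_contradiction[of B' l p "p - m" "w + m * l"] cop[of "p - m"] N m l card 2
      by auto
  qed
qed

text \<open>A preimage rather than an image, so that no inverse of \<open>v\<close> is needed and
  compositions multiply out. For \<open>v\<close> prime to \<open>p\<close> this ranges over all
  affine images of a set of residues.\<close>

definition aff_preimage :: "int \<Rightarrow> int \<Rightarrow> int \<Rightarrow> int set \<Rightarrow> int set" where
  "aff_preimage p u v A = {0..<p} \<inter> {x. (u + v * x) mod p \<in> A}"

lemma aff_preimage_aff_preimage: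
  assumes "0 < p"
  shows "aff_preimage p u' v' (aff_preimage p u v A) = aff_preimage p (u + v * u') (v * v') A"
proof -
  have "(u + v * ((u' + v' * x) mod p)) mod p = (u + v * u' + v * v' * x) mod p" for x
    by (metis (no_types, opaque_lifting) add.assoc distrib_left mod_add_right_eq mod_mult_right_eq mult.assoc)
  then show ?thesis
    using assms by (auto simp: aff_preimage_def)
qed

lemma card_aff_preimage:
  assumes "prime p" "\<not> p dvd v" "A \<subseteq> {0..<p}"
  shows "card (aff_preimage p u v A) = card A"
proof -
  have p: "0 < p"
    using assms(1) prime_gt_0_int by blast
  have cop: "coprime v p"
    using assms(1,2) by (meson coprime_commute prime_imp_coprime)
  have "inj_on (\<lambda>x. (u + v * x) mod p) (aff_preimage p u v A)"
  proof (rule inj_onI)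
    fix x y assume xy: "x \<in> aff_preimage p u v A" "y \<in> aff_preimage p u v A"
      "(u + v * x) mod p = (u + v * y) mod p"
    then have "[u + v * x = u + v * y] (mod p)"
      by (simp add: cong_def)
    then have "[x = y] (mod p)"
      using cop by (simp add: cong_add_lcancel cong_mult_lcancel)
    then show "x = y"
      using xy by (simp add: cong_def aff_preimage_def)
  qed
  moreover have "(\<lambda>x. (u + v * x) mod p) ` aff_preimage p u v A = A"
  proof (intro equalityI subsetI)
    fix a assume a: "a \<in> A"
    obtain v' where v': "[v * v' = 1] (mod p)"
      using cop cong_solve_coprime_int by blast
    have "[v * (v' * (a - u)) = 1 * (a - u)] (mod p)"
      unfolding mult.assoc[symmetric] by (rule cong_mult[OF v' cong_refl])
    then have "[u + v * (v' * (a - u)) = u + 1 * (a - u)] (mod p)"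
      by (rule cong_add[OF cong_refl])
    then have "(u + v * ((v' * (a - u)) mod p)) mod p = a mod p"
      by (simp add: cong_def) (metis mod_add_right_eq mod_mult_right_eq)
    then have "(u + v * ((v' * (a - u)) mod p)) mod p = a"
      using a assms(3) by auto
    then show "a \<in> (\<lambda>x. (u + v * x) mod p) ` aff_preimage p u v A"
      using a p by (intro image_eqI[where x = "(v' * (a - u)) mod p"]) (auto simp: aff_preimage_def)
  qed (auto simp: aff_preimage_def)
  ultimately show ?thesis
    using card_image by fastforce
qed

text \<open>The offset \<open>w\<close> is there because the equation \<open>x + y = m z\<close> is
  not translation invariant for \<open>m\<close> other than 2. The hypothesis \<open>small\<close>
  gives Freiman's condition for \<open>B\<close>, prevents wrap-around in \<open>E - B\<close>, and,
  since \<open>n \<le> N\<close>, makes \<open>N + n\<close> exceed \<open>p / 2\<close>, so that an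
  interval of length \<open>N + n - 1\<close> missed by \<open>A\<close> leaves only a half
  arc.\<close>

lemma normalized_solution_free_contradiction:
  fixes A :: "int set" and p m w l :: int
  defines "h \<equiv> (p - 1) div 2" and "N \<equiv> int (card A)"
  defines "B \<equiv> A \<inter> {0..h}"
  defines "n \<equiv> int (card B)"
  assumes "prime p" and A: "A \<subseteq> {0..<p}" and m: "2 \<le> m" "m \<le> p - 2"
    and free: "\<And>x y z. x \<in> A \<Longrightarrow> y \<in> A \<Longrightarrow> z \<in> A \<Longrightarrow> \<not> [x + y = m * z + w] (mod p)"
    and B: "0 \<in> B" "l \<in> B" "B \<subseteq> {0..l}" "Gcd B = 1"
    and max: "\<And>u. int (card (aff_preimage p u 1 A \<inter> {0..h})) \<le> n"
    and small: "p + 4 \<le> 3 * n + N" and N: "3 * p + 5 \<le> 10 * N"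
  shows False
proof -
  have p: "4 \<le> p" "0 < p"
    using m by auto
  have "odd p"
    using \<open>prime p\<close> p prime_odd_int by force
  then have h: "2 * h = p - 1"
    by (simp add: h_def)
  have fin: "finite A" "finite B"
    using A finite_subset unfolding B_def by blast+
  have BA: "B \<subseteq> A"
    by (auto simp: B_def)
  have nN: "n \<le> N"
    unfolding n_def N_def using card_mono[OF fin(1) BA] by simp
  have cop: "coprime m p"
    using m by (intro coprime_prime_int_less[OF \<open>prime p\<close>]) auto
  have A_eqI: "x = y" if "x \<in> A" "y \<in> A" "[x = y] (mod p)" for x y
    using that A by (intro cong_less_imp_eq_int[of x p y]) auto
  define E where "E = (\<lambda>z. (m * z + w) mod p) ` A"
  have "inj_on (\<lambda>z. (m * z + w) mod p) A"
  proof (rule inj_onI)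
    fix x y assume xy: "x \<in> A" "y \<in> A" "(m * x + w) mod p = (m * y + w) mod p"
    then have "[m * x + w = m * y + w] (mod p)"
      by (simp add: cong_def)
    then have "[x = y] (mod p)"
      using cop by (simp add: cong_add_rcancel cong_mult_lcancel)
    then show "x = y"
      using A_eqI xy by blast
  qed
  then have cardE: "int (card E) = N"
    by (simp add: E_def N_def card_image)
  have E: "E \<subseteq> {0..<p}" "finite E"
    using p fin by (auto simp: E_def)
  have BB: "B + B \<subseteq> {0..<p}"
    using h by (auto simp: B_def elim!: set_plus_elim)
  have "(B + B) \<inter> E = {}"
  proof -
    have "b + c \<notin> E" if "b \<in> B" "c \<in> B" for b c
    proof
      assume "b + c \<in> E"
      then obtain z where "z \<in> A" "b + c = (m * z + w) mod p"
        by (auto simp: E_def)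
      then have "[b + c = m * z + w] (mod p)"
        by (simp add: cong_def)
      then show False
        using free[of b c z] that BA \<open>z \<in> A\<close> by blast
    qed
    then show ?thesis
      by (auto elim!: set_plus_elim)
  qed
  then have "card (B + B) + card E = card ((B + B) \<union> E)"
    using fin E by (simp add: card_Un_disjoint finite_set_plus)
  also have "\<dots> \<le> card {0..<p}"
    using BB E by (intro card_mono) auto
  finally have cardBB: "int (card (B + B)) \<le> p - N"
    using cardE p by simp
  then have "card (B + B) + 4 \<le> 3 * card B"
    using small by (simp add: n_def)
  note F = Freiman_3k_minus_4[OF B(3,1,2,4) this]
  have ln: "l + n \<le> p - N"
    using F(1) cardBB by (simp add: n_def)
  obtain k where k: "{k..<k + 2 * n - 1} \<subseteq> B + B"
    using F(2) by (auto simp: n_def)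
  have n: "1 \<le> n"
    using small nN ln B(2,3) by auto
  \<comment> \<open>The first integer after the interval; subtracting it moves the gap of
    \<open>E\<close> to the top of \<open>{0..<p}\<close>.\<close>
  define d where "d = k + 2 * n - 1"
  have "k \<in> B + B" "d - 1 \<in> B + B"
    using k n by (auto simp: d_def)
  then have kd: "0 \<le> k" "d \<le> p"
    using BB by auto
  define E' where "E' = (\<lambda>e. (e - d) mod p) ` E"
  have "inj_on (\<lambda>e. (e - d) mod p) E"
  proof (rule inj_onI)
    fix x y assume xy: "x \<in> E" "y \<in> E" "(x - d) mod p = (y - d) mod p"
    then have "[x - d + d = y - d + d] (mod p)"
      by (intro cong_add) (simp_all add: cong_def)
    then show "x = y"
      using xy E by (intro cong_less_imp_eq_int[of x p y]) auto
  qed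
  then have cardE': "int (card E') = N"
    using cardE by (simp add: E'_def card_image)
  have E': "E' \<subseteq> {0..p - 2 * n}"
  proof
    fix x assume "x \<in> E'"
    then obtain e where e: "e \<in> E" "x = (e - d) mod p"
      by (auto simp: E'_def)
    have "e \<notin> {k..<d}"
      using k \<open>(B + B) \<inter> E = {}\<close> e by (auto simp: d_def)
    then consider "d \<le> e" | "e < k"
      by fastforce
    then show "x \<in> {0..p - 2 * n}"
    proof cases
      case 1
      moreover have "e < p"
        using e E by auto
      ultimately have "x = e - d"
        using e kd n by (simp add: d_def)
      then show ?thesis
        using 1 \<open>e < p\<close> kd by (simp add: d_def)
    next
      case 2
      moreover have "0 \<le> e"
        using e E by auto
      moreover have "x = (e - d + p) mod p"
        using e by simp
      moreover have "(e - d + p) mod p = e - d + p"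
        using 2 \<open>0 \<le> e\<close> kd n by (intro mod_pos_pos_trivial) (auto simp: d_def)
      ultimately have "x = e - d + p"
        by simp
      then show ?thesis
        using 2 \<open>0 \<le> e\<close> kd by (simp add: d_def)
    qed
  qed
  have finE': "finite E'" "E' \<noteq> {}"
    using E cardE' N p by (auto simp: E'_def)
  define e0 where "e0 = Min E'"
  define a where "a = Max E' - e0"
  define X where "X = (\<lambda>e. e - e0) ` E'"
  define Y where "Y = (\<lambda>b. l - b) ` B"
  have e0: "e0 \<in> E'" "Max E' \<in> E'"
    using finE' by (auto simp: e0_def)
  have X: "X \<subseteq> {0..a}" "0 \<in> X" "a \<in> X" "int (card X) = N"
    using e0 finE' cardE' by (auto simp: X_def a_def e0_def card_image inj_on_def)
  have Y: "Y \<subseteq> {0..l}" "0 \<in> Y" "l \<in> Y" "int (card Y) = n"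
    using B by (auto simp: Y_def n_def card_image inj_on_def)
  have "e0 \<in> {0..p - 2 * n}" "Max E' \<in> {0..p - 2 * n}"
    using e0 E' by blast+
  then have a: "0 \<le> a" "a \<le> p - 2 * n"
    using X(1,2) by (auto simp: a_def)
  define S where "S = X + Y"
  \<comment> \<open>The diameters add up to at most \<open>(p - 2 * n) + (p - N - n)\<close>, which
    \<open>small\<close> makes less than \<open>p\<close>.\<close>
  have S: "S \<subseteq> {0..<p}"
    using X(1) Y(1) a ln small nN by (fastforce simp: S_def elim!: set_plus_elim)
  \<comment> \<open>Undoes the shifts by \<open>d\<close> and \<open>e0\<close> and the reflection
    at \<open>l\<close>: modulo \<open>p\<close>, \<open>s + c\<close> is a difference
    \<open>e - b\<close>.\<close>
  define c where "c = e0 + d - l"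
  have SA: "(s + c) mod p \<notin> A" if "s \<in> S" for s
  proof
    assume sA: "(s + c) mod p \<in> A"
    from that obtain x y where "x \<in> X" "y \<in> Y" "s = x + y"
      by (auto simp: S_def elim!: set_plus_elim)
    then obtain e z b where z: "z \<in> A" "e = (m * z + w) mod p" and b: "b \<in> B"
      and s: "s = (e - d) mod p - e0 + (l - b)"
      by (auto simp: X_def Y_def E'_def E_def)
    have "[(e - d) mod p + d = (e - d) + d] (mod p)"
      by (rule cong_add) (simp_all add: cong_def)
    then have "[(s + c) + b = m * z + w] (mod p)"
      using z by (simp add: s c_def cong_def)
    then have "[(s + c) mod p + b = m * z + w] (mod p)"
      by (simp add: cong_def mod_simps)
    then show False
      using free[OF sA, of b z] b z BA by auto
  qed
  have "inj_on (\<lambda>s. (s + c) mod p) S"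
  proof (rule inj_onI)
    fix x y assume xy: "x \<in> S" "y \<in> S" "(x + c) mod p = (y + c) mod p"
    then have "[x + c = y + c] (mod p)"
      by (simp add: cong_def)
    then show "x = y"
      using xy S by (intro cong_less_imp_eq_int[of x p y]) (auto simp: cong_add_rcancel)
  qed
  then have "card S + card A = card ((\<lambda>s. (s + c) mod p) ` S) + card A"
    by (simp add: card_image)
  also have "\<dots> = card ((\<lambda>s. (s + c) mod p) ` S \<union> A)"
    using SA fin finite_subset[OF S] by (subst card_Un_disjoint) auto
  also have "\<dots> \<le> card {0..<p}"
    using A p by (intro card_mono) auto
  finally have cardS: "int (card S) \<le> p - N"
    using p by (simp add: N_def)
  obtain r where r: "{r..<r + N + n - 1} \<subseteq> S"
  \<comment> \<open>\<open>sumset_long_interval\<close> wants the set of larger diameter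
    first.\<close>
  proof (cases "l \<le> a")
    case True
    have "a + 3 \<le> int (card X) + int (card Y)"
      "int (card (X + Y)) < int (card X) + 2 * int (card Y) - 3"
      using X Y a small nN cardS by (auto simp: S_def)
    moreover have "Y \<subseteq> {0..a}"
      using Y True by auto
    ultimately show ?thesis
      using sumset_long_interval[OF X(1-3) _ Y(2)] that X(4) Y(4) by (metis S_def)
  next
    case False
    have "l + 3 \<le> int (card Y) + int (card X)"
      "int (card (Y + X)) < int (card Y) + 2 * int (card X) - 3"
      using X Y ln small nN cardS by (auto simp: S_def add.commute)
    moreover have "X \<subseteq> {0..l}"
      using X False by auto
    ultimately obtain r where "{r..<r + n + N - 1} \<subseteq> Y + X"
      using sumset_long_interval[OF Y(1-3) _ X(2)] X(4) Y(4) by metis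
    then show ?thesis
      using that[of r] by (simp add: S_def add.commute add.left_commute)
  qed
  \<comment> \<open>New origin just after the interval missed by \<open>A\<close>. The remaining
    \<open>p - N - n + 1\<close> places fit into \<open>{0..h}\<close>, because
    \<open>2 * (N + n)\<close> is at least \<open>3 * n + N\<close>.\<close>
  define u where "u = r + N + n - 1 + c"
  have "aff_preimage p u 1 A \<subseteq> {0..h}"
  proof
    fix x assume x: "x \<in> aff_preimage p u 1 A"
    show "x \<in> {0..h}"
    proof (rule ccontr)
      assume "x \<notin> {0..h}"
      then have "h < x" "x < p" "(u + x) mod p \<in> A"
        using x by (auto simp: aff_preimage_def)
      then have "r + N + n - 1 + x - p \<in> S"
        using r small nN h by (intro subsetD[OF r]) auto
      then have "(r + N + n - 1 + x - p + c) mod p \<notin> A"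
        by (rule SA)
      moreover have "r + N + n - 1 + x - p + c = u + x - p"
        by (simp add: u_def)
      ultimately show False
        using \<open>(u + x) mod p \<in> A\<close> by simp
    qed
  qed
  then have "int (card (aff_preimage p u 1 A)) \<le> n"
    using max[of u] by (simp add: Int_absorb2)
  moreover have "card (aff_preimage p u 1 A) = card A"
    using \<open>prime p\<close> A p by (intro card_aff_preimage) auto
  ultimately have "n = N"
    using nN by (simp add: N_def)
  then have "B = A"
    using card_subset_eq[OF fin(1) BA] by (simp add: n_def N_def)
  show False
  proof (rule affine_multiplier_contradiction[OF \<open>prime p\<close> B(3) _ _ m])
    show "l \<le> p - 2 * int (card B)"
      using ln \<open>n = N\<close> by (simp add: n_def)
    show "3 * p + 5 \<le> 10 * int (card B)"
      using N \<open>n = N\<close> by (simp add: n_def)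
    fix b assume "b \<in> B"
    then have "((m * b + w) mod p - d) mod p \<in> E'"
      using BA by (auto simp: E'_def E_def)
    then have "((m * b + w) mod p - d) mod p \<le> p - 2 * n"
      using E' by auto
    moreover have "((m * b + w) mod p - d) mod p = (m * b + (w - d)) mod p"
      by (simp add: mod_simps algebra_simps)
    ultimately show "(m * b + (w - d)) mod p \<le> p - 2 * int (card B)"
      by (simp add: n_def)
  qed
qed

text \<open>The least \<open>L\<close> for which some maximal part fits into \<open>{0..L}\<close>
  yields the normalization: a part without 0 could be moved down, one without \<open>L\<close> would
  fit into a shorter interval, and a common divisor could be absorbed into the multiplier
  \<open>v\<close>.\<close>

lemma solution_free_contradiction:
  fixes A :: "int set" and p m :: int and n :: nat
  defines "h \<equiv> (p - 1) div 2"
  assumes "prime p" and A: "A \<subseteq> {0..<p}" and m: "2 \<le> m" "m \<le> p - 2"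
    and free: "\<And>x y z. x \<in> A \<Longrightarrow> y \<in> A \<Longrightarrow> z \<in> A \<Longrightarrow> \<not> [x + y = m * z] (mod p)"
    and max: "\<And>u v. \<not> p dvd v \<Longrightarrow> card (aff_preimage p u v A \<inter> {0..h}) \<le> n"
    and attained: "\<not> p dvd v0" "card (aff_preimage p u0 v0 A \<inter> {0..h}) = n"
    and small: "p + 4 \<le> 3 * int n + int (card A)" and N: "3 * p + 5 \<le> 10 * int (card A)"
  shows False
proof -
  define Q where "Q = (\<lambda>L::nat. \<exists>u v. \<not> p dvd v \<and> card (aff_preimage p u v A \<inter> {0..h}) = n
    \<and> aff_preimage p u v A \<inter> {0..h} \<subseteq> {0..int L})"
  have QI: "Q L" if "\<not> p dvd v" "B \<subseteq> aff_preimage p u v A \<inter> {0..h}" "card B = n" "B \<subseteq> {0..int L}"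
    for u v B L
  proof -
    have "B = aff_preimage p u v A \<inter> {0..h}"
      using max[OF that(1), of u] that(2,3) by (intro card_seteq) auto
    then show ?thesis
      using that by (auto simp: Q_def)
  qed
  have "Q (nat h)"
    using attained by (auto simp: Q_def)
  define L where "L = (LEAST L. Q L)"
  have "Q L"
    unfolding L_def using \<open>Q (nat h)\<close> by (rule LeastI)
  then obtain u v where v: "\<not> p dvd v" and cardB: "card (aff_preimage p u v A \<inter> {0..h}) = n"
    and BL: "aff_preimage p u v A \<inter> {0..h} \<subseteq> {0..int L}"
    by (auto simp: Q_def)
  have least: "L \<le> L'" if "Q L'" for L'
    unfolding L_def using that by (rule Least_le)
  define A' where "A' = aff_preimage p u v A"
  define B where "B = A' \<inter> {0..h}"
  have B: "card B = n" "B \<subseteq> {0..int L}" "B \<subseteq> aff_preimage p u v A \<inter> {0..h}"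
    using cardB BL by (auto simp: B_def A'_def)
  have A': "A' \<subseteq> {0..<p}"
    by (auto simp: A'_def aff_preimage_def)
  have cardA': "card A' = card A"
    unfolding A'_def by (rule card_aff_preimage[OF \<open>prime p\<close> v A])
  have "card A \<le> card {0..<p}"
    using A by (intro card_mono) auto
  then have n2: "2 \<le> n"
    using small m by simp
  have finB: "finite B"
    by (auto simp: B_def)
  have "B \<noteq> {}"
    using B n2 by auto
  have B0: "0 \<in> B"
  proof (rule ccontr)
    assume "0 \<notin> B"
    then have pos: "1 \<le> b" if "b \<in> B" for b
      using that B(2) by (cases "b = 0") force+
    then have "1 \<le> L"
      using \<open>B \<noteq> {}\<close> B(2) by force
    have "(\<lambda>b. b - 1) ` B \<subseteq> aff_preimage p (u + v) v A \<inter> {0..h}"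
      using pos B(3) by (force simp: aff_preimage_def algebra_simps)
    moreover have "card ((\<lambda>b. b - 1) ` B) = n"
      using B by (simp add: card_image inj_on_def)
    moreover have "b - 1 \<in> {0..int (L - 1)}" if "b \<in> B" for b
      using pos[OF that] subsetD[OF B(2) that] \<open>1 \<le> L\<close> by (auto simp: of_nat_diff)
    then have "(\<lambda>b. b - 1) ` B \<subseteq> {0..int (L - 1)}"
      by blast
    ultimately have "Q (L - 1)"
      by (rule QI[OF v])
    then show False
      using least[of "L - 1"] \<open>1 \<le> L\<close> by simp
  qed
  have "B \<noteq> {0}"
    using B(1) n2 by auto
  then obtain b where b: "b \<in> B" "b \<noteq> 0"
    using B0 by auto
  then have "1 \<le> L"
    using B(2) by force
  have LB: "int L \<in> B"
  proof (rule ccontr)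
    assume "int L \<notin> B"
    then have "b \<le> int (L - 1)" if "b \<in> B" for b
      using that B(2) \<open>1 \<le> L\<close> by (cases "b = int L") (force simp: of_nat_diff)+
    then have "B \<subseteq> {0..int (L - 1)}"
      using B(2) by auto
    then have "Q (L - 1)"
      by (rule QI[OF v B(3,1)])
    then show False
      using least[of "L - 1"] \<open>1 \<le> L\<close> by simp
  qed
  have gcd: "Gcd B = 1"
  proof (rule ccontr)
    assume "Gcd B \<noteq> 1"
    define d where "d = Gcd B"
    have dvd: "d dvd b" if "b \<in> B" for b
      using that by (simp add: d_def)
    then have "d \<noteq> 0"
      using b by force
    then have d: "2 \<le> d"
      using \<open>Gcd B \<noteq> 1\<close> Gcd_int_greater_eq_0[of B] unfolding d_def by linarith
    have "d \<le> int L"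
      using dvd[OF LB] \<open>1 \<le> L\<close> by (intro zdvd_imp_le) auto
    moreover have "int L < p"
      using LB A' by (auto simp: B_def)
    ultimately have "\<not> p dvd d"
      using d zdvd_not_zless[of d p] by auto
    then have vd: "\<not> p dvd v * d"
      using v \<open>prime p\<close> by (simp add: prime_dvd_mult_iff)
    have div: "b div d \<le> b" if "0 \<le> b" for b
      using zdiv_mono2[of b 1 d] that d by simp
    have "(\<lambda>b. b div d) ` B \<subseteq> aff_preimage p u (v * d) A \<inter> {0..h}"
    proof
      fix x assume "x \<in> (\<lambda>b. b div d) ` B"
      then obtain b where b: "b \<in> B" "x = b div d"
        by auto
      then have "d * x = b" "0 \<le> b" "b \<le> h" "b < p" "(u + v * b) mod p \<in> A"
        using dvd[of b] B(3) by (auto simp: aff_preimage_def)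
      moreover from this have "0 \<le> x" "x \<le> b"
        using b div[of b] d by (auto simp: pos_imp_zdiv_nonneg_iff)
      ultimately show "x \<in> aff_preimage p u (v * d) A \<inter> {0..h}"
        by (auto simp: aff_preimage_def mult.assoc)
    qed
    moreover have "card ((\<lambda>b. b div d) ` B) = n"
      using B(1) dvd by (subst card_image) (auto intro!: inj_onI, metis dvd_mult_div_cancel)
    moreover have "(\<lambda>b. b div d) ` B \<subseteq> {0..int (nat (int L div d))}"
      using B(2) d by (auto simp: pos_imp_zdiv_nonneg_iff zdiv_mono1)
    ultimately have "Q (nat (int L div d))"
      by (rule QI[OF vd])
    then have "int L \<le> int L div d"
      using least \<open>1 \<le> L\<close> d by (fastforce simp: le_nat_iff pos_imp_zdiv_nonneg_iff)
    then show False
      using d \<open>1 \<le> L\<close> int_div_less_self[of "int L" d] by simp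
  qed
  have "coprime v p"
    using \<open>prime p\<close> v by (meson coprime_commute prime_imp_coprime)
  then obtain v' where v': "[v * v' = 1] (mod p)"
    using cong_solve_coprime_int by blast
  show False
  \<comment> \<open>Substituting \<open>u + v * x\<close> into the equation leaves the constant
    \<open>(m - 2) * u\<close>, which is divided by \<open>v\<close> to give the offset.\<close>
  proof (rule normalized_solution_free_contradiction[OF \<open>prime p\<close> A' m, of "v' * ((m - 2) * u)" "int L"])
    fix x y z assume xyz: "x \<in> A'" "y \<in> A'" "z \<in> A'"
    show "\<not> [x + y = m * z + v' * ((m - 2) * u)] (mod p)"
    proof
      assume "[x + y = m * z + v' * ((m - 2) * u)] (mod p)"
      then have "[2 * u + v * (x + y) = 2 * u + v * (m * z + v' * ((m - 2) * u))] (mod p)"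
        by (rule cong_add[OF cong_refl cong_mult[OF cong_refl]])
      moreover have "[(v * v') * ((m - 2) * u) = 1 * ((m - 2) * u)] (mod p)"
        by (rule cong_mult[OF v' cong_refl])
      then have "[(2 * u + v * (m * z)) + (v * v') * ((m - 2) * u)
          = (2 * u + v * (m * z)) + 1 * ((m - 2) * u)] (mod p)"
        by (rule cong_add[OF cong_refl])
      ultimately have "[(u + v * x) + (u + v * y) = m * (u + v * z)] (mod p)"
        by (simp add: algebra_simps cong_def)
      then have "[(u + v * x) mod p + (u + v * y) mod p = m * ((u + v * z) mod p)] (mod p)"
        by (simp add: cong_def mod_simps)
      then show False
        using free xyz by (auto simp: A'_def aff_preimage_def)
    qed
  next
    fix u'
    show "int (card (aff_preimage p u' 1 A' \<inter> {0..(p - 1) div 2})) \<le> int (card (A' \<inter> {0..(p - 1) div 2}))"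
      using max[OF v, of "u + v * u'"] B(1) m
      by (simp add: A'_def aff_preimage_aff_preimage B_def h_def)
  qed (use B0 LB B gcd small N cardA' in \<open>simp_all add: B_def h_def\<close>)
qed

section \<open>Points on a circle\<close>

lemma sum_cos_arith_progression:
  fixes b t :: real
  shows "2 * sin (t / 2) * (\<Sum>i<M. cos (b + t * real i)) = 2 * sin (t * real M / 2) * cos (b + t * (real M - 1) / 2)"
proof -
  have prod: "2 * sin x * cos y = sin (y + x) - sin (y - x)" for x y :: real
    by (simp add: sin_add sin_diff)
  have "2 * sin (t / 2) * (\<Sum>i<M. cos (b + t * real i))
      = (\<Sum>i<M. sin (b + t * real i + t / 2) - sin (b + t * real i - t / 2))"
    by (simp only: sum_distrib_left prod)
  also have "\<dots> = (\<Sum>i<M. sin (b - t / 2 + t * real (Suc i)) - sin (b - t / 2 + t * real i))"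
    by (intro sum.cong refl) (simp add: algebra_simps)
  also have "\<dots> = sin (b - t / 2 + t * real M) - sin (b - t / 2)"
    by (subst sum_lessThan_telescope) simp
  also have "\<dots> = 2 * sin (t * real M / 2) * cos (b + t * (real M - 1) / 2)"
  proof -
    have "b + t * (real M - 1) / 2 + t * real M / 2 = b - t / 2 + t * real M"
      "b + t * (real M - 1) / 2 - t * real M / 2 = b - t / 2"
      by (simp_all add: field_simps)
    then show ?thesis
      by (simp only: prod)
  qed
  finally show ?thesis .
qed

lemma has_integral_level:
  fixes v T :: real
  assumes "0 \<le> T"
  shows "((\<lambda>s. if s \<le> v then 1 else 0 :: real) has_integral (max 0 (min v T))) {0..T}"
proof (cases "0 \<le> v")
  case True
  have "((\<lambda>s. 1 :: real) has_integral (min v T)) {0..min v T}"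
    using has_integral_const_real[of "1::real" 0 "min v T"] True assms by simp
  then have "((\<lambda>s. if s \<in> {0..min v T} then 1 else 0 :: real) has_integral (min v T)) {0..T}"
    by (subst has_integral_restrict) auto
  then have "((\<lambda>s. if s \<le> v then 1 else 0 :: real) has_integral (min v T)) {0..T}"
    by (rule has_integral_eq[rotated]) auto
  then show ?thesis
    using True assms by simp
next
  case False
  have "((\<lambda>s. 0 :: real) has_integral 0) {0..T}"
    by simp
  then have "((\<lambda>s. if s \<le> v then 1 else 0 :: real) has_integral 0) {0..T}"
    by (rule has_integral_eq[rotated]) (use False in auto)
  then show ?thesis
    using False by simp
qed

text \<open>Layer-cake bound: only the excess over the threshold \<open>T\<close> escapes the level-set hypothesis.\<close>

lemma sum_le_by_level_sets:
  fixes f :: "'a \<Rightarrow> real"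
  assumes "finite X" "0 \<le> T"
    and level: "\<And>s. 0 \<le> s \<Longrightarrow> s \<le> T \<Longrightarrow> card {x \<in> X. s \<le> f x} \<le> M + card {x \<in> X. f x \<le> - s}"
  shows "(\<Sum>x\<in>X. f x) \<le> (\<Sum>x\<in>X. max 0 (f x - T)) + real M * T"
proof -
  define c where "c = (\<lambda>x. max 0 (min (f x) T) - max 0 (min (- f x) T))"
  have "((\<lambda>s. \<Sum>x\<in>X. (if s \<le> f x then 1 else 0) - (if s \<le> - f x then 1 else 0)) has_integral (\<Sum>x\<in>X. c x)) {0..T}"
    unfolding c_def using assms by (intro has_integral_sum has_integral_diff has_integral_level)
  moreover have "((\<lambda>s. real M) has_integral (T * real M)) {0..T}"
    using has_integral_const_real[of "real M" 0 T] assms by simp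
  moreover have "(\<Sum>x\<in>X. (if s \<le> f x then 1 else 0) - (if s \<le> - f x then 1 else 0)) \<le> real M"
    if "s \<in> {0..T}" for s
  proof -
    have "(\<Sum>x\<in>X. (if s \<le> f x then 1 else 0) - (if s \<le> - f x then 1 else 0) :: real)
        = real (card {x \<in> X. s \<le> f x}) - real (card {x \<in> X. s \<le> - f x})"
      using assms(1) by (simp add: sum_subtractf sum.If_cases Int_def)
    moreover have "{x \<in> X. s \<le> - f x} = {x \<in> X. f x \<le> - s}"
      by auto
    ultimately show ?thesis
      using level[of s] that by simp
  qed
  ultimately have "(\<Sum>x\<in>X. c x) \<le> T * real M"
    by (rule has_integral_le)
  moreover have "(\<Sum>x\<in>X. f x) \<le> (\<Sum>x\<in>X. max 0 (f x - T) + c x)"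
    by (intro sum_mono) (use assms(2) in \<open>auto simp: c_def max_def min_def\<close>)
  ultimately show ?thesis
    by (simp add: sum.distrib mult.commute)
qed

section \<open>Exponential sums over residues with few points in every half circle\<close>

context
  fixes p :: int and X :: "int set" and n :: nat
  assumes p: "odd p" "0 < p" and X: "X \<subseteq> {0..<p}"
    and half: "\<And>j. card {x \<in> X. (x - j) mod p \<le> (p - 1) div 2} \<le> n"
begin

lemma finite_residues: "finite X"
  using X finite_subset by blast

text \<open>Integer starting points suffice: as \<open>p\<close> is odd, the residues in a closed
  half circle starting at \<open>t\<close> are among the \<open>(p + 1) / 2\<close> consecutive ones
  from \<open>\<lceil>t\<rceil>\<close> on.\<close>

lemma card_half_circle_le: "card {x \<in> X. 0 \<le> sin (2 * pi * (real_of_int x - t) / p)} \<le> n"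
proof -
  have "(x - \<lceil>t\<rceil>) mod p \<le> (p - 1) div 2" if sin: "0 \<le> sin (2 * pi * (real_of_int x - t) / p)" for x
  proof -
    define q where "q = \<lfloor>(x - t) / p\<rfloor>"
    define y where "y = x - t - p * q"
    have "q \<le> (x - t) / p" "(x - t) / p < q + 1"
      unfolding q_def by linarith+
    then have y: "0 \<le> y" "y < p"
      using p by (simp_all add: y_def field_simps)
    have "2 * pi * (x - t) / p = 2 * pi * y / p + 2 * pi * q"
      using p by (simp add: y_def field_simps)
    then have "0 \<le> sin (2 * pi * y / p)"
      using sin by (simp add: sin_add)
    moreover have "sin (2 * pi * y / p) < 0" if "p / 2 < y"
    proof (rule sin_lt_zero)
      show "pi < 2 * pi * y / p" "2 * pi * y / p < 2 * pi"
        using that y p by (simp_all add: field_simps)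
    qed
    ultimately have y2: "y \<le> p / 2"
      by linarith
    define z where "z = x - \<lceil>t\<rceil> - p * q"
    have "real_of_int z = y - (\<lceil>t\<rceil> - t)"
      by (simp add: z_def y_def)
    then have "real_of_int z \<le> p / 2" "- 1 < real_of_int z"
      using y y2 ceiling_correct[of t] by linarith+
    then have z: "2 * z \<le> p" "0 \<le> z"
      by linarith+
    have "x - \<lceil>t\<rceil> = z + p * q"
      by (simp add: z_def)
    then have "(x - \<lceil>t\<rceil>) mod p = z mod p"
      by (simp only: mod_mult_self2)
    also have "\<dots> = z"
      using z p by simp
    also have "z \<le> (p - 1) div 2"
      using z(1) p(1) by presburger
    finally show ?thesis .
  qed
  then have "card {x \<in> X. 0 \<le> sin (2 * pi * (real_of_int x - t) / p)}
      \<le> card {x \<in> X. (x - \<lceil>t\<rceil>) mod p \<le> (p - 1) div 2}"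
    using finite_residues by (intro card_mono) auto
  then show ?thesis
    using half[of "\<lceil>t\<rceil>"] by simp
qed

text \<open>The two half circles starting at the end points of the arc \<open>{x. s \<le> cos x}\<close> both contain
  this arc and together miss only its antipode.\<close>

lemma card_level_set_le:
  fixes w s :: real and f :: "int \<Rightarrow> real"
  defines "f \<equiv> (\<lambda>x. cos (2 * pi * (x - w) / p))"
  assumes s: "0 \<le> s" "s \<le> 1"
  shows "card {x \<in> X. s \<le> f x} + card X \<le> 2 * n + card {x \<in> X. f x \<le> - s}"
proof -
  define a where "a = arccos s"
  define k where "k = sin a"
  have ca: "cos a = s"
    using s by (simp add: a_def)
  have "0 \<le> a" "a \<le> pi"
    using s by (auto simp: a_def intro: arccos_lbound arccos_ubound)
  then have k: "0 \<le> k" "k\<^sup>2 = 1 - s\<^sup>2"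
    using ca sin_ge_zero[of a] sin_squared_eq[of a] by (auto simp: k_def)
  define u :: "int \<Rightarrow> real" where "u = (\<lambda>x. 2 * pi * (x - w) / p)"
  define H1 where "H1 = {x \<in> X. 0 \<le> sin (u x + a)}"
  define H2 where "H2 = {x \<in> X. 0 \<le> sin (a - u x)}"
  have "2 * pi * (x - (w - a * p / (2 * pi))) / p = u x + a" for x :: int
    using p by (simp add: u_def field_simps)
  then have "card H1 \<le> n"
    using card_half_circle_le[of "w - a * p / (2 * pi)"] by (simp add: H1_def)
  have eq2: "2 * pi * (x - (w + a * p / (2 * pi) - p / 2)) / p = u x - a + pi" for x :: int
    using p by (simp add: u_def field_simps)
  have "sin (u x - a + pi) = sin (a - u x)" for x
    by (metis minus_diff_eq sin_minus sin_periodic_pi)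
  then have "card H2 \<le> n"
    using card_half_circle_le[of "w + a * p / (2 * pi) - p / 2"] by (simp add: H2_def eq2)
  \<comment> \<open>Applied to the cosine \<open>x\<close> and plus or minus the sine
    \<open>y\<close> of \<open>u\<close>, where \<open>s * y + k * x\<close> is the sine that
    decides membership in \<open>H1\<close> or \<open>H2\<close>. The first part says that the arc
    lies in both half circles, the second that they leave out only the antipodal arc.\<close>
  have sin_s: "0 \<le> s * y + k * x \<or> \<not> s \<le> x" "s \<le> x \<or> x \<le> - s \<or> y < 0 \<or> 0 \<le> s * y + k * x"
    if "x\<^sup>2 + y\<^sup>2 = 1" for x y :: real
  proof -
    show "0 \<le> s * y + k * x \<or> \<not> s \<le> x"
    proof (cases "s \<le> x")
      case True
      then have "s\<^sup>2 \<le> x\<^sup>2"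
        using s by (intro power_mono) auto
      then have "\<bar>y\<bar>\<^sup>2 \<le> k\<^sup>2"
        using that k by simp
      then have "\<bar>y\<bar> \<le> k"
        using k by (meson abs_ge_zero power2_le_imp_le)
      then have "s * (- k) \<le> s * y" "k * s \<le> k * x"
        using s(1) k(1) True by (intro mult_left_mono; linarith)+
      then show ?thesis by (simp add: mult.commute)
    qed simp
    show "s \<le> x \<or> x \<le> - s \<or> y < 0 \<or> 0 \<le> s * y + k * x"
    proof (cases "\<bar>x\<bar> < s \<and> 0 \<le> y")
      case True
      then have "\<bar>x\<bar>\<^sup>2 \<le> s\<^sup>2"
        by (intro power_mono) auto
      then have "k\<^sup>2 \<le> y\<^sup>2"
        using that k by simp
      then have "k \<le> y"
        using True by (meson power2_le_imp_le)
      then have "s * k \<le> s * y" "k * (- s) \<le> k * x"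
        using s(1) k(1) True by (intro mult_left_mono; linarith)+
      then show ?thesis by (simp add: mult.commute)
    qed auto
  qed
  have f: "f x = cos (u x)" for x
    by (simp add: f_def u_def)
  have sin_u: "sin (u x + a) = s * sin (u x) + k * f x" "sin (a - u x) = s * (- sin (u x)) + k * f x" for x
    by (simp_all add: sin_add sin_diff ca k_def f mult.commute)
  have pyth: "(f x)\<^sup>2 + (sin (u x))\<^sup>2 = 1" "(f x)\<^sup>2 + (- sin (u x))\<^sup>2 = 1" for x
    by (simp_all add: f)
  have "{x \<in> X. s \<le> f x} \<subseteq> H1 \<inter> H2"
    using sin_s(1)[OF pyth(1)] sin_s(1)[OF pyth(2)] by (auto simp: H1_def H2_def sin_u)
  then have "card {x \<in> X. s \<le> f x} \<le> card (H1 \<inter> H2)"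
    using finite_residues by (intro card_mono) (auto simp: H1_def)
  moreover have "X \<subseteq> (H1 \<union> H2) \<union> {x \<in> X. f x \<le> - s}"
  proof
    fix x assume "x \<in> X"
    then show "x \<in> (H1 \<union> H2) \<union> {x \<in> X. f x \<le> - s}"
      using sin_s[OF pyth(1)[of x]] sin_s[OF pyth(2)[of x]] unfolding H1_def H2_def sin_u by force
  qed
  then have "card X \<le> card ((H1 \<union> H2) \<union> {x \<in> X. f x \<le> - s})"
    using finite_residues by (intro card_mono) (auto simp: H1_def H2_def)
  then have "card X \<le> card (H1 \<union> H2) + card {x \<in> X. f x \<le> - s}"
    using card_Un_le order_trans by blast
  moreover have "card H1 + card H2 = card (H1 \<union> H2) + card (H1 \<inter> H2)"
    using finite_residues by (intro card_Un_Int) (auto simp: H1_def H2_def)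
  ultimately show ?thesis
    using \<open>card H1 \<le> n\<close> \<open>card H2 \<le> n\<close> by linarith
qed

text \<open>The points with \<open>f\<close> above \<open>T\<close> lie on an open arc of
  \<open>M\<close> spacings, so their representatives near \<open>w\<close> fall into a block of
  \<open>M\<close> consecutive integers. Completing the block adds only terms \<open>f z - T\<close>
  that are nonnegative; the multiples of \<open>T\<close> cancel and a trigonometric progression
  remains.\<close>

lemma sum_above_threshold_le:
  fixes w T :: real and M :: nat and f :: "int \<Rightarrow> real"
  defines "f \<equiv> (\<lambda>x. cos (2 * pi * (x - w) / p))"
  defines "T \<equiv> cos (pi * M / p)"
  assumes M: "2 * int M \<le> p"
  shows "(\<Sum>x\<in>X. max 0 (f x - T)) + M * T \<le> sin (pi * M / p) / sin (pi / p)"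
proof -
  define X' where "X' = {x \<in> X. T < f x}"
  define W where "W = {\<lceil>w - M / 2\<rceil>..<\<lceil>w - M / 2\<rceil> + int M}"
  \<comment> \<open>The representative of \<open>x\<close> modulo \<open>p\<close> within distance
    \<open>p / 2\<close> of \<open>w\<close>.\<close>
  define r :: "int \<Rightarrow> int" where "r = (\<lambda>x. x - p * \<lfloor>(x - w) / p + 1 / 2\<rfloor>)"
  have fr: "f (r x) = f x" for x
  proof -
    have "2 * pi * (x - w) / p = 2 * pi * (r x - w) / p + 2 * pi * \<lfloor>(x - w) / p + 1 / 2\<rfloor>"
      using p by (simp add: r_def field_simps)
    then show ?thesis
      by (simp add: f_def cos_add)
  qed
  have inj: "inj_on r X'"
  proof (rule inj_onI)
    fix x y assume xy: "x \<in> X'" "y \<in> X'" "r x = r y"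
    then have "x mod p = y mod p"
      by (simp add: r_def) (metis mod_mult_self2 diff_conv_add_uminus mult_minus_right)
    then show "x = y"
      using xy X by (auto simp: X'_def subset_iff)
  qed
  have "r ` X' \<subseteq> W"
  proof
    fix z assume "z \<in> r ` X'"
    then obtain x where x: "x \<in> X'" "z = r x"
      by auto
    define q where "q = \<lfloor>(x - w) / p + 1 / 2\<rfloor>"
    have "\<bar>(x - w) / p - q\<bar> \<le> 1 / 2"
      unfolding q_def by linarith
    then have "real_of_int p * \<bar>(x - w) / p - q\<bar> \<le> p * (1 / 2)"
      using p by (intro mult_left_mono) auto
    moreover have "real_of_int z = x - p * q"
      by (simp add: x r_def q_def)
    then have "real_of_int z - w = p * ((x - w) / p) - p * q"
      using p by simp
    then have "real_of_int z - w = p * ((x - w) / p - q)"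
      by (simp only: right_diff_distrib of_int_mult)
    ultimately have zw: "\<bar>z - w\<bar> \<le> p / 2"
      using p by (simp add: abs_mult)
    have "T < cos (2 * pi * \<bar>z - w\<bar> / p)"
    proof -
      have "T < f x"
        using x(1) by (simp add: X'_def)
      also have "f x = f z"
        by (simp only: x(2) fr)
      also have "f z = cos \<bar>2 * pi * (z - w) / p\<bar>"
        by (simp only: f_def cos_abs_real)
      also have "\<bar>2 * pi * (z - w) / p\<bar> = 2 * pi * \<bar>z - w\<bar> / p"
        using p by (simp add: abs_mult)
      finally show ?thesis .
    qed
    moreover have "2 * pi * \<bar>z - w\<bar> / p \<le> pi"
      using zw p by (simp add: field_simps)
    moreover have "0 \<le> pi * M / p"
      using p by simp
    ultimately have "2 * pi * \<bar>z - w\<bar> / p < pi * M / p"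
      using cos_monotone_0_pi_le[of "pi * M / p" "2 * pi * \<bar>z - w\<bar> / p"] unfolding T_def by linarith
    then have "\<bar>z - w\<bar> < M / 2"
      using p by (simp add: field_simps)
    then have "w - M / 2 < z" "z < w - M / 2 + M"
      by linarith+
    then show "z \<in> W"
      unfolding W_def by (simp add: ceiling_le_iff) linarith
  qed
  have fW: "T \<le> f z" if "z \<in> W" for z
  proof -
    have "w - M / 2 \<le> z" "z < w - M / 2 + M"
      using that unfolding W_def by (simp_all add: ceiling_le_iff) linarith+
    then have "\<bar>z - w\<bar> \<le> M / 2"
      by linarith
    then have "2 * pi * \<bar>z - w\<bar> / p \<le> pi * M / p"
      using p by (simp add: field_simps)
    moreover have "pi * M / p \<le> pi"
      using M p by (simp add: field_simps)
    ultimately have "T \<le> cos (2 * pi * \<bar>z - w\<bar> / p)"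
      unfolding T_def using p by (intro cos_monotone_0_pi_le) auto
    also have "2 * pi * \<bar>z - w\<bar> / p = \<bar>2 * pi * (z - w) / p\<bar>"
      using p by (simp add: abs_mult)
    finally show ?thesis
      by (simp only: f_def cos_abs_real)
  qed
  have "(\<Sum>x\<in>X. max 0 (f x - T)) = (\<Sum>x\<in>X'. f x - T)"
    unfolding X'_def using finite_residues by (intro sum.mono_neutral_cong_right) auto
  also have "\<dots> = (\<Sum>z\<in>r ` X'. f z - T)"
    using inj by (simp add: sum.reindex fr)
  also have "\<dots> \<le> (\<Sum>z\<in>W. f z - T)"
    using \<open>r ` X' \<subseteq> W\<close> fW by (intro sum_mono2) (auto simp: W_def)
  also have "\<dots> = (\<Sum>z\<in>W. f z) - M * T"
    by (simp add: sum_subtractf W_def)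
  also have "(\<Sum>z\<in>W. f z) = (\<Sum>i<M. f (\<lceil>w - M / 2\<rceil> + int i))"
    by (rule sum.reindex_bij_witness[of _ "\<lambda>i. \<lceil>w - M / 2\<rceil> + int i" "\<lambda>z. nat (z - \<lceil>w - M / 2\<rceil>)"])
      (auto simp: W_def)
  also have "\<dots> = (\<Sum>i<M. cos (2 * pi * (real_of_int \<lceil>w - real M / 2\<rceil> - w) / real_of_int p + 2 * pi / p * real i))"
    by (intro sum.cong refl) (simp add: f_def add_divide_distrib[symmetric] algebra_simps)
  finally have le: "(\<Sum>x\<in>X. max 0 (f x - T)) + M * T
      \<le> (\<Sum>i<M. cos (2 * pi * (real_of_int \<lceil>w - real M / 2\<rceil> - w) / real_of_int p + 2 * pi / p * real i))"
    by simp
  have "1 < p \<or> p = 1"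
    using p by linarith
  then show ?thesis
  proof
    assume "1 < p"
    then have pos: "0 < sin (pi / p)"
      by (intro sin_gt_zero) (auto simp: field_simps)
    have "0 \<le> sin (pi * M / p)"
      using M p by (intro sin_ge_zero) (auto simp: field_simps)
    then have "sin (pi * M / p) * cos y \<le> sin (pi * M / p)" for y
      by (simp add: mult_left_le)
    then have "sin (pi / p) * (\<Sum>i<M. cos (2 * pi * (real_of_int \<lceil>w - real M / 2\<rceil> - w) / real_of_int p + 2 * pi / p * real i)) \<le> sin (pi * M / p)"
      using sum_cos_arith_progression[of "2 * pi / p" "2 * pi * (real_of_int \<lceil>w - real M / 2\<rceil> - w) / real_of_int p" M]
      by simp
    then have "(\<Sum>i<M. cos (2 * pi * (real_of_int \<lceil>w - real M / 2\<rceil> - w) / real_of_int p + 2 * pi / p * real i))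
        \<le> sin (pi * M / p) / sin (pi / p)"
      using pos by (simp add: pos_le_divide_eq mult.commute)
    then show ?thesis
      using le by linarith
  next
    assume "p = 1"
    then have "M = 0" using M by simp
    then show ?thesis using le by simp
  qed
qed

text \<open>For arbitrary unit vectors the bound would be \<open>2 n - card X\<close>; distinctness
  of the \<open>p\<close>-th roots of unity improves it to the norm of a sum of \<open>M\<close>
  consecutive ones. After rotating the sum to the positive real axis, layers up to
  \<open>T = cos (pi M / p)\<close> are bounded by \<open>M\<close> each, and the excess above
  \<open>T\<close> is handled by the preceding lemma.\<close>

lemma norm_exponential_sum_le:
  assumes M: "2 * n \<le> card X + M" "2 * int M \<le> p"
  shows "norm (\<Sum>x\<in>X. cis (2 * pi * x / p)) \<le> sin (pi * M / p) / sin (pi / p)"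
proof -
  define S where "S = (\<Sum>x\<in>X. cis (2 * pi * x / p))"
  define w where "w = Arg S * p / (2 * pi)"
  define f :: "int \<Rightarrow> real" where "f = (\<lambda>x. cos (2 * pi * (x - w) / p))"
  define T where "T = cos (pi * M / p)"
  have f: "f x = Re (cis (2 * pi * x / p) * cis (- Arg S))" for x
  proof -
    have "2 * pi * (x - w) / p = 2 * pi * x / p - Arg S"
      using p by (simp add: w_def diff_divide_distrib right_diff_distrib)
    then show ?thesis
      by (simp add: f_def cis_mult)
  qed
  have "S * cis (- Arg S) = rcis (norm S) (Arg S) * cis (- Arg S)"
    by (simp only: rcis_cmod_Arg)
  then have "norm S = Re (S * cis (- Arg S))"
    by (simp add: rcis_def mult.assoc cis_mult)
  also have "\<dots> = (\<Sum>x\<in>X. f x)"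
    by (simp only: S_def sum_distrib_right Re_sum f)
  also have "\<dots> \<le> (\<Sum>x\<in>X. max 0 (f x - T)) + real M * T"
  proof (rule sum_le_by_level_sets[OF finite_residues])
    have "pi * M / p \<le> pi / 2"
      using M p by (simp add: field_simps)
    then show "0 \<le> T"
      unfolding T_def using p by (intro cos_ge_zero) (auto intro: order_trans[of _ 0])
    fix s assume "0 \<le> s" "s \<le> T"
    then show "card {x \<in> X. s \<le> f x} \<le> M + card {x \<in> X. f x \<le> - s}"
      using card_level_set_le[of s w] M(1) order_trans[OF _ cos_le_one, of s "pi * M / p"]
      by (simp add: f_def T_def)
  qed
  also have "\<dots> \<le> sin (pi * M / p) / sin (pi / p)"
    unfolding f_def T_def by (rule sum_above_threshold_le[OF M(2)])
  finally show ?thesis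
    by (simp add: S_def)
qed

end

section \<open>Large Fourier coefficients\<close>

lemma sum_characters:
  fixes k :: int and P :: nat
  assumes "0 < P"
  shows "(\<Sum>r<P. cis (2 * pi * (real r * k) / P)) = (if int P dvd k then of_nat P else 0)"
proof -
  define u where "u = cis (2 * pi * k / P)"
  have u: "cis (2 * pi * (real r * k) / P) = u ^ r" for r
  proof -
    have "2 * pi * (real r * k) / P = real r * (2 * pi * k / P)"
      by simp
    then show ?thesis
      by (simp only: u_def Complex.DeMoivre)
  qed
  have "u ^ P = 1"
    using assms cis_multiple_2pi[of "of_int k"] by (simp add: u_def Complex.DeMoivre)
  have "u = 1 \<longleftrightarrow> int P dvd k"
  proof
    assume "u = 1"
    then have "cos (2 * pi * k / P) = 1"
      by (metis u_def cis.sel(1) one_complex.sel(1))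
    then obtain n :: int where "2 * pi * k / P = n * 2 * pi"
      by (auto simp: cos_one_2pi_int)
    then have "real_of_int k = real_of_int (n * int P)"
      using assms by (simp add: field_simps)
    then have "k = n * int P"
      by (simp only: of_int_eq_iff)
    then show "int P dvd k" by simp
  next
    assume "int P dvd k"
    then obtain n where "k = int P * n"
      by auto
    then have "2 * pi * k / P = 2 * pi * of_int n"
      using assms by simp
    then show "u = 1"
      using cis_multiple_2pi[of "of_int n"] by (simp only: u_def Ints_of_int)
  qed
  then show ?thesis
    using \<open>u ^ P = 1\<close> by (auto simp: u geometric_sum)
qed

text \<open>The character count of solutions is zero, so the trivial term \<open>N ^ 3\<close> is
  balanced by the others. In those, \<open>T\<close> bounds the factor at \<open>m * r\<close>, and
  Parseval gives \<open>N * P - N\<^sup>2\<close> for the sum of the remaining squares.\<close>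

lemma exponential_sum_bound_imp_card_le:
  fixes A :: "int set" and P :: nat and m :: int and T :: real
  defines "S \<equiv> (\<lambda>r::int. \<Sum>a\<in>A. cis (2 * pi * (r * a) / P))"
  assumes A: "A \<subseteq> {0..<int P}" "A \<noteq> {}" and P: "0 < P"
    and free: "\<And>x y z. x \<in> A \<Longrightarrow> y \<in> A \<Longrightarrow> z \<in> A \<Longrightarrow> \<not> [x + y = m * z] (mod int P)"
    and T: "\<And>r. \<not> int P dvd r \<Longrightarrow> norm (S r) \<le> T"
    and m: "\<And>r. int P dvd m * r \<Longrightarrow> int P dvd r"
  shows "(real (card A))\<^sup>2 \<le> T * (real P - real (card A))"
proof -
  define N where "N = card A"
  have fin: "finite A"
    using A(1) finite_subset by blast
  then have N: "0 < N"
    using \<open>A \<noteq> {}\<close> by (simp add: N_def card_gt_0_iff)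
  have cnjS: "cnj (S r) = (\<Sum>a\<in>A. cis (- (2 * pi * (r * a) / P)))" for r
    by (simp add: S_def cis_cnj)
  have "(\<Sum>r<P. S r * S r * cnj (S (m * r))) = (\<Sum>r<P. \<Sum>x\<in>A. \<Sum>y\<in>A. \<Sum>z\<in>A. cis (2 * pi * (real r * (x + y - m * z)) / P))"
  proof (intro sum.cong refl)
    fix r :: nat
    have "S r * S r = (\<Sum>x\<in>A. \<Sum>y\<in>A. cis (2 * pi * (int r * x) / P) * cis (2 * pi * (int r * y) / P))"
      by (simp only: S_def sum_product)
    then have "S r * S r * cnj (S (m * r)) = (\<Sum>x\<in>A. \<Sum>y\<in>A. \<Sum>z\<in>A. cis (2 * pi * (int r * x) / P)
        * cis (2 * pi * (int r * y) / P) * cis (- (2 * pi * (m * int r * z) / P)))"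
      by (simp only: cnjS sum_distrib_right) (simp only: sum_distrib_left)
    also have "\<dots> = (\<Sum>x\<in>A. \<Sum>y\<in>A. \<Sum>z\<in>A. cis (2 * pi * (real r * (x + y - m * z)) / P))"
      by (intro sum.cong refl) (simp add: cis_mult add_divide_distrib[symmetric] diff_divide_distrib[symmetric] algebra_simps)
    finally show "S r * S r * cnj (S (m * r)) = (\<Sum>x\<in>A. \<Sum>y\<in>A. \<Sum>z\<in>A. cis (2 * pi * (real r * (x + y - m * z)) / P))" .
  qed
  also have "\<dots> = (\<Sum>x\<in>A. \<Sum>y\<in>A. \<Sum>z\<in>A. \<Sum>r<P. cis (2 * pi * (real r * (x + y - m * z)) / P))"
    by (subst sum.swap, rule sum.cong[OF refl], subst sum.swap, rule sum.cong[OF refl], rule sum.swap)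
  also have "\<dots> = (\<Sum>x\<in>A. \<Sum>y\<in>A. \<Sum>z\<in>A. 0)"
  proof (intro sum.cong refl)
    fix x y z assume "x \<in> A" "y \<in> A" "z \<in> A"
    then have "\<not> int P dvd x + y - m * z"
      using free by (simp add: cong_iff_dvd_diff)
    then show "(\<Sum>r<P. cis (2 * pi * (real r * (x + y - m * z)) / P)) = 0"
      using sum_characters[OF P, of "x + y - m * z"] by simp
  qed
  finally have triple: "(\<Sum>r<P. S r * S r * cnj (S (m * r))) = 0"
    by simp
  have "(\<Sum>r<P. S r * cnj (S r)) = (\<Sum>r<P. \<Sum>x\<in>A. \<Sum>y\<in>A. cis (2 * pi * (real r * (x - y)) / P))"
  proof (intro sum.cong refl)
    fix r :: nat
    have "S r * cnj (S r) = (\<Sum>x\<in>A. \<Sum>y\<in>A. cis (2 * pi * (int r * x) / P) * cis (- (2 * pi * (int r * y) / P)))"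
      unfolding cnjS by (simp only: S_def sum_product)
    also have "\<dots> = (\<Sum>x\<in>A. \<Sum>y\<in>A. cis (2 * pi * (real r * (x - y)) / P))"
      by (intro sum.cong refl) (simp add: cis_mult diff_divide_distrib[symmetric] algebra_simps)
    finally show "S r * cnj (S r) = (\<Sum>x\<in>A. \<Sum>y\<in>A. cis (2 * pi * (real r * (x - y)) / P))" .
  qed
  also have "\<dots> = (\<Sum>x\<in>A. \<Sum>y\<in>A. \<Sum>r<P. cis (2 * pi * (real r * (x - y)) / P))"
    by (subst sum.swap, rule sum.cong[OF refl], rule sum.swap)
  also have "\<dots> = (\<Sum>x\<in>A. \<Sum>y\<in>A. if x = y then of_nat P else 0)"
  proof (intro sum.cong refl)
    fix x y assume xy: "x \<in> A" "y \<in> A"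
    have "int P dvd x - y \<longleftrightarrow> x = y"
    proof
      assume "int P dvd x - y"
      then have "[x = y] (mod int P)"
        by (simp add: cong_iff_dvd_diff)
      then show "x = y"
        using A xy by (intro cong_less_imp_eq_int[of x "int P" y]) auto
    qed simp
    then show "(\<Sum>r<P. cis (2 * pi * (real r * (x - y)) / P)) = (if x = y then of_nat P else 0)"
      using sum_characters[OF P, of "x - y"] by simp
  qed
  also have "\<dots> = of_nat (N * P)"
    using fin by (simp add: N_def)
  finally have "(\<Sum>r<P. of_real ((norm (S r))\<^sup>2)) = (of_real (real (N * P)) :: complex)"
    by (simp only: complex_norm_square of_real_of_nat_eq)
  then have parseval: "(\<Sum>r<P. (norm (S r))\<^sup>2) = real (N * P)"
    by (metis of_real_eq_iff of_real_sum)
  have S0: "S 0 = of_nat N"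
    by (simp add: S_def N_def)
  have split: "(\<Sum>r<P. g r) = g 0 + (\<Sum>r\<in>{1..<P}. g r)" for g :: "nat \<Rightarrow> 'b::comm_monoid_add"
    using P by (simp add: lessThan_atLeast0 sum.atLeast_Suc_lessThan)
  have "norm (S 0 * S 0 * cnj (S 0)) = norm (\<Sum>r\<in>{1..<P}. S r * S r * cnj (S (m * r)))"
    using triple split[of "\<lambda>r. S r * S r * cnj (S (m * r))"] by (simp add: add_eq_0_iff2)
  also have "\<dots> \<le> (\<Sum>r\<in>{1..<P}. norm (S r * S r * cnj (S (m * r))))"
    by (rule norm_sum)
  also have "\<dots> \<le> (\<Sum>r\<in>{1..<P}. (norm (S r))\<^sup>2 * T)"
  proof (rule sum_mono)
    fix r assume "r \<in> {1..<P}"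
    then have "\<not> int P dvd int r"
      by (auto dest: zdvd_imp_le)
    then have "norm (S (m * r)) \<le> T"
      using m by (intro T) blast
    then show "norm (S r * S r * cnj (S (m * r))) \<le> (norm (S r))\<^sup>2 * T"
      by (simp add: norm_mult power2_eq_square mult_left_mono)
  qed
  also have "\<dots> = (real (N * P) - (real N)\<^sup>2) * T"
    using parseval split[of "\<lambda>r. (norm (S r))\<^sup>2"] S0 by (simp add: sum_distrib_right[symmetric])
  finally have "real N * (real N)\<^sup>2 \<le> real N * (T * (real P - real N))"
    using S0 by (simp add: norm_mult power2_eq_square algebra_simps)
  then show ?thesis
    using N by (simp add: N_def)
qed

lemma cis_mod:
  fixes k :: int and P :: nat
  assumes "0 < P"
  shows "cis (2 * pi * (k mod int P) / P) = cis (2 * pi * k / P)"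
proof -
  have "real_of_int k = real_of_int (int P * (k div int P) + k mod int P)"
    by simp
  then have "real_of_int k = real P * (k div int P) + k mod int P"
    by (simp only: of_int_add of_int_mult of_int_of_nat_eq)
  then have "2 * pi * k / P = 2 * pi * (k mod int P) / P + 2 * pi * of_int (k div int P)"
    using assms by (simp add: field_simps)
  then have "cis (2 * pi * k / P) = cis (2 * pi * (k mod int P) / P) * cis (2 * pi * of_int (k div int P))"
    by (simp only: cis_mult)
  then show ?thesis
    using cis_multiple_2pi[of "of_int (k div int P)"] by simp
qed

text \<open>The coefficient of \<open>A\<close> at \<open>r\<close> is the exponential sum of the
  dilate \<open>X\<close> at frequency 1, and the half circles of \<open>X\<close> correspond to
  affine preimages of \<open>A\<close> with multiplier inverse to \<open>r\<close>.\<close>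

lemma half_arc_bound_imp_card_le:
  fixes A :: "int set" and P n M :: nat and m :: int
  assumes "prime P" "odd P" and A: "A \<subseteq> {0..<int P}" "A \<noteq> {}"
    and free: "\<And>x y z. x \<in> A \<Longrightarrow> y \<in> A \<Longrightarrow> z \<in> A \<Longrightarrow> \<not> [x + y = m * z] (mod int P)"
    and m: "\<not> int P dvd m"
    and max: "\<And>u v. \<not> int P dvd v \<Longrightarrow> card (aff_preimage P u v A \<inter> {0..(int P - 1) div 2}) \<le> n"
    and M: "2 * n \<le> card A + M" "2 * M \<le> P"
  shows "(real (card A))\<^sup>2 \<le> sin (pi * M / P) / sin (pi / P) * (real P - real (card A))"
proof (rule exponential_sum_bound_imp_card_le[OF A _ free])
  have prime: "prime (int P)"
    using \<open>prime P\<close> by simp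
  show P: "0 < P"
    using \<open>prime P\<close> prime_gt_0_nat by blast
  show "int P dvd r" if "int P dvd m * r" for r
    using that prime m prime_dvd_multD by blast
  fix r :: int
  assume r: "\<not> int P dvd r"
  then have cop: "coprime r (int P)"
    using prime by (meson coprime_commute prime_imp_coprime)
  then obtain r' where r': "[r * r' = 1] (mod int P)"
    using cong_solve_coprime_int by blast
  have ndvd: "\<not> int P dvd r'"
  proof
    assume "int P dvd r'"
    then have "[r * r' = 0] (mod int P)"
      by (simp add: cong_0_iff)
    then have "[1 = 0] (mod int P)"
      using r' cong_sym cong_trans by blast
    then show False
      using prime by (simp add: cong_0_iff)
  qed
  have inv: "(r' * (r * a mod int P)) mod int P = a" if "a \<in> A" for a
  proof -
    have "[(r * r') * a = 1 * a] (mod int P)"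
      by (rule cong_mult[OF r' cong_refl])
    then have "(r' * (r * a mod int P)) mod int P = a mod int P"
      by (simp add: cong_def mod_mult_right_eq mult_ac)
    also have "\<dots> = a"
      using that A by auto
    finally show ?thesis .
  qed
  define X where "X = (\<lambda>a. r * a mod int P) ` A"
  have inj: "inj_on (\<lambda>a. r * a mod int P) A"
    by (rule inj_on_inverseI[where g = "\<lambda>x. (r' * x) mod int P"]) (rule inv)
  have "norm (\<Sum>x\<in>X. cis (2 * pi * x / real_of_int (int P))) \<le> sin (pi * M / real_of_int (int P)) / sin (pi / real_of_int (int P))"
  proof (rule norm_exponential_sum_le)
    show "odd (int P)" "0 < int P" "2 * n \<le> card X + M" "2 * int M \<le> int P"
      using \<open>odd P\<close> P M inj by (auto simp: X_def card_image)
    show "X \<subseteq> {0..<int P}"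
      using P by (auto simp: X_def)
    fix j
    have "{x \<in> X. (x - j) mod int P \<le> (int P - 1) div 2}
        \<subseteq> (\<lambda>y. (y + j) mod int P) ` (aff_preimage P (r' * j) r' A \<inter> {0..(int P - 1) div 2})"
    proof
      fix x assume "x \<in> {x \<in> X. (x - j) mod int P \<le> (int P - 1) div 2}"
      then obtain a where a: "a \<in> A" "x = r * a mod int P" and le: "(x - j) mod int P \<le> (int P - 1) div 2"
        by (auto simp: X_def)
      have "(r' * j + r' * ((x - j) mod int P)) mod int P = (r' * j + r' * (x - j)) mod int P"
        by (metis mod_add_right_eq mod_mult_right_eq)
      also have "\<dots> = (r' * x) mod int P"
        by (simp add: algebra_simps)
      also have "\<dots> = a"
        using inv[OF a(1)] a(2) by simp
      finally have "(x - j) mod int P \<in> aff_preimage P (r' * j) r' A \<inter> {0..(int P - 1) div 2}"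
        using le a(1) P by (simp add: aff_preimage_def)
      moreover have "x = ((x - j) mod int P + j) mod int P"
        using a(2) by (simp add: mod_simps)
      ultimately show "x \<in> (\<lambda>y. (y + j) mod int P) ` (aff_preimage P (r' * j) r' A \<inter> {0..(int P - 1) div 2})"
        by (rule image_eqI[rotated])
    qed
    then have "card {x \<in> X. (x - j) mod int P \<le> (int P - 1) div 2}
        \<le> card ((\<lambda>y. (y + j) mod int P) ` (aff_preimage P (r' * j) r' A \<inter> {0..(int P - 1) div 2}))"
      by (intro card_mono) auto
    also have "\<dots> \<le> card (aff_preimage P (r' * j) r' A \<inter> {0..(int P - 1) div 2})"
      by (intro card_image_le) auto
    also have "\<dots> \<le> n"
      by (rule max[OF ndvd])
    finally show "card {x \<in> X. (x - j) mod int P \<le> (int P - 1) div 2} \<le> n" .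
  qed
  also have "(\<Sum>x\<in>X. cis (2 * pi * x / real_of_int (int P))) = (\<Sum>a\<in>A. cis (2 * pi * (r * a) / P))"
    unfolding X_def using cis_mod[OF P] by (simp add: sum.reindex[OF inj])
  finally show "norm (\<Sum>a\<in>A. cis (2 * pi * (r * a) / P)) \<le> sin (pi * M / P) / sin (pi / P)"
    by simp
qed

section \<open>Comparing the Fourier bound with the condition on \<open>c\<close>\<close>

lemma sin_mult_le:
  assumes "1 \<le> k" "0 \<le> x" "k * x \<le> pi"
  shows "sin (k * x) \<le> k * sin x"
proof -
  have "concave_on {0..pi} sin"
  proof (rule f''_le0_imp_concave)
    show "(sin has_real_derivative cos x) (at x)" "(cos has_real_derivative - sin x) (at x)" for x :: real
      by (auto intro!: derivative_eq_intros)
  qed (auto intro: sin_ge_zero)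
  then have "(1 - 1 / k) * sin 0 + 1 / k * sin (k * x) \<le> sin ((1 - 1 / k) *\<^sub>R 0 + (1 / k) *\<^sub>R (k * x))"
    using assms by (intro concave_onD) auto
  then show ?thesis
    using assms by (simp add: field_simps)
qed

text \<open>The number \<open>k\<close> is the ratio of
  \<open>pi * (2 * P + 6 - 5 * c * P) / (3 * P)\<close>, the largest possible angle
  \<open>pi * M / P\<close>, to \<open>pi * c / 3\<close>. The lower bound on \<open>c\<close>
  amounts to \<open>3 * P + 5 \<le> 10 * c * P\<close>, the upper one to \<open>1 \<le> k\<close>,
  which concavity of the sine requires.\<close>

lemma solution_free_card_less:
  fixes P :: nat and A :: "int set" and m :: int and c :: real
  defines "k \<equiv> 2 / c + 6 / (c * P) - 5"
  assumes P: "prime P" "80 \<le> P" and m: "2 \<le> m" "m \<le> int P - 2"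
    and c: "0 < c" "3 / 10 + 1 / (2 * real P) \<le> c" "c \<le> 1 / 3 + 1 / real P"
    and Q: "k * (k + 3) / 2 \<le> c * P * sin (pi / P) / sin (pi * c / 3)"
    and A: "A \<subseteq> {0..<int P}"
    and free: "\<And>x y z. x \<in> A \<Longrightarrow> y \<in> A \<Longrightarrow> z \<in> A \<Longrightarrow> \<not> [x + y = m * z] (mod int P)"
  shows "real (card A) < c * P"
proof (rule ccontr)
  assume "\<not> real (card A) < c * P"
  define N where "N = card A"
  have N: "c * P \<le> N"
    using \<open>\<not> real (card A) < c * P\<close> by (simp add: N_def)
  have "3 * real P + 5 \<le> 10 * (c * P)"
    using c(2) P(2) by (simp add: field_simps)
  then have N10: "3 * P + 5 \<le> 10 * N" and cP: "3 * real P + 5 \<le> 10 * (c * P)"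
    using N by linarith+
  have "odd P"
    using P prime_odd_nat by force
  have ne: "A \<noteq> {}"
    using N10 by (auto simp: N_def)
  define h where "h = (int P - 1) div 2"
  define K where "K = {card (aff_preimage P u v A \<inter> {0..h}) |u v. \<not> int P dvd v}"
  have "K \<subseteq> {..P}"
  proof -
    have "card (aff_preimage P u v A \<inter> {0..h}) \<le> card {0..<int P}" for u v
      by (intro card_mono) (auto simp: aff_preimage_def)
    then show ?thesis
      by (auto simp: K_def)
  qed
  then have finK: "finite K"
    using finite_subset by blast
  have "\<not> int P dvd 1"
    using P by auto
  then have neK: "K \<noteq> {}"
    unfolding K_def by blast
  define n where "n = Max K"
  have max: "card (aff_preimage P u v A \<inter> {0..h}) \<le> n" if "\<not> int P dvd v" for u v
    unfolding n_def using finK that by (intro Max_ge) (auto simp: K_def)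
  have "n \<in> K"
    unfolding n_def using finK neK by (rule Max_in)
  then obtain u0 v0 where attained: "\<not> int P dvd v0" "card (aff_preimage P u0 v0 A \<inter> {0..h}) = n"
    unfolding K_def by blast
  have "int P + 4 \<le> 3 * int n + int N"
  proof (rule ccontr)
    assume "\<not> ?thesis"
    then have small: "3 * n + N \<le> P + 3"
      by linarith
    define M where "M = 2 * n - N"
    have bound: "(real N)\<^sup>2 \<le> sin (pi * M / P) / sin (pi / P) * (real P - real N)"
      unfolding N_def
    proof (rule half_arc_bound_imp_card_le[OF P(1) \<open>odd P\<close> A ne free])
      show "\<not> int P dvd m"
        using m zdvd_not_zless[of m "int P"] by auto
      show "2 * n \<le> card A + M" "2 * M \<le> P"
        using small N10 P(2) by (auto simp: M_def N_def)
    qed (use max in \<open>auto simp: h_def\<close>)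
    have "0 < N"
      using N10 by linarith
    \<comment> \<open>The truncated difference is the true \<open>2 * n - N\<close> only when it is
      nonzero; if it were 0, the bound would read \<open>N\<^sup>2 \<le> 0\<close>.\<close>
    have "M \<noteq> 0"
      using bound \<open>0 < N\<close> by (intro notI) simp
    define y where "y = k * (pi * c / 3)"
    have y: "y = pi * ((2 * real P + 6 - 5 * (c * P)) / 3) / P"
      using c(1) P(2) by (simp add: y_def k_def field_simps)
    have M: "real M \<le> (2 * real P + 6 - 5 * (c * P)) / 3"
      using small \<open>M \<noteq> 0\<close> N by (simp add: M_def)
    have "(2 * real P + 6 - 5 * (c * P)) / 3 \<le> P / 2"
    proof -
      have "80 \<le> real P"
        using P(2) by simp
      then show ?thesis
        using cP by (simp add: field_simps)
    qed
    then have "y \<le> pi * (P / 2) / P"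
      unfolding y using P(2) by (intro divide_right_mono mult_left_mono) auto
    then have y_le: "y \<le> pi / 2"
      using P(2) by simp
    have My: "pi * M / P \<le> y"
      unfolding y using M P(2) by (intro divide_right_mono mult_left_mono) auto
    have "0 \<le> pi * M / P"
      by simp
    then have "- (pi / 2) \<le> pi * M / P"
      using pi_gt_zero by linarith
    then have "sin (pi * M / P) \<le> sin y"
      using My y_le by (intro sin_monotone_2pi_le) auto
    also have k1: "1 \<le> k"
      using c(1,3) P(2) by (simp add: k_def field_simps)
    have "sin y \<le> k * sin (pi * c / 3)"
      unfolding y_def using k1 c(1) y_le by (intro sin_mult_le) (auto simp: y_def)
    finally have sinM: "sin (pi * M / P) \<le> k * sin (pi * c / 3)" .
    define s1 where "s1 = sin (pi / P)"
    define s3 where "s3 = sin (pi * c / 3)"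
    have s1: "0 < s1"
      unfolding s1_def using P(2) by (intro sin_gt_zero) (auto simp: field_simps)
    have "c < 1"
    proof -
      have "1 / real P \<le> 1 / 80"
        using P(2) by (intro divide_left_mono) auto
      then show ?thesis
        using c(3) by linarith
    qed
    then have s3: "0 < s3"
      unfolding s3_def using c(1) by (intro sin_gt_zero) (auto simp: field_simps)
    define T where "T = sin (pi * M / P) / s1"
    have "0 \<le> sin (pi * M / P)"
      using My y_le pi_gt_zero by (intro sin_ge_zero) (simp, linarith)
    then have T0: "0 \<le> T"
      using s1 by (simp add: T_def)
    have "T * s1 \<le> k * s3"
      using sinM s1 by (simp add: T_def s3_def)
    have q: "k * (k + 3) / 2 * s3 \<le> c * P * s1"
      using Q s3 by (simp add: s1_def s3_def pos_le_divide_eq)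
    have "T * s1 * ((k + 3) / 2) \<le> k * s3 * ((k + 3) / 2)"
      using \<open>T * s1 \<le> k * s3\<close> k1 by (intro mult_right_mono) auto
    also have "\<dots> \<le> c * P * s1"
      using q by (simp add: algebra_simps)
    finally have "(T * ((k + 3) / 2)) * s1 \<le> (c * P) * s1"
      by (simp add: algebra_simps)
    then have "T * ((k + 3) / 2) \<le> c * P"
      using s1 by (simp only: mult_le_cancel_right)
    then have "T * ((k + 3) / 2) * c \<le> c * P * c"
      using c(1) by (intro mult_right_mono) auto
    \<comment> \<open>This is why \<open>k * (k + 3) / 2\<close> is the right quantity: one factor
      \<open>k\<close> bounds \<open>T\<close>, the other becomes \<open>1 - c\<close> up to the
      slack \<open>3 / P\<close>, and that slack contradicts the Parseval bound
      \<open>low\<close>.\<close>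
    moreover have "(k + 3) / 2 * c = 1 + 3 / P - c"
      using c(1) P(2) by (simp add: k_def field_simps)
    ultimately have up: "T * (1 + 3 / P - c) \<le> c * P * c"
      by (metis mult.assoc)
    have "(c * P)\<^sup>2 \<le> (real N)\<^sup>2"
      using N c(1) by (intro power_mono) auto
    also have "\<dots> \<le> T * (real P - real N)"
      using bound by (simp add: T_def s1_def)
    also have "\<dots> \<le> T * (real P - c * P)"
      using N T0 by (intro mult_left_mono) auto
    finally have "(c * P * c) * P \<le> (T * (1 - c)) * P"
      by (simp add: power2_eq_square algebra_simps)
    then have low: "c * P * c \<le> T * (1 - c)"
      using P(2) by (simp add: mult_ac)
    have "T * (1 + 3 / P - c) = T * (1 - c) + T * (3 / P)"
      by (simp add: algebra_simps)
    then have "T * (3 / P) \<le> 0"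
      using up low by linarith
    moreover have "0 < T"
    proof -
      have "0 < c * P * c"
        using c(1) P(2) by simp
      then have "T \<noteq> 0"
        using low by auto
      then show ?thesis
        using T0 by simp
    qed
    then have "0 < T * (3 / P)"
      using P(2) by simp
    ultimately show False
      by simp
  qed
  then show False
    using solution_free_contradiction[of "int P" A m n v0 u0] P(1) A m free max attained N10
    unfolding h_def N_def by auto
qed

section \<open>The density bound\<close>

lemma d_mod_less:
  fixes p m :: nat and c :: real
  defines "k \<equiv> 2 / c + 6 / (c * p) - 5"
  assumes p: "prime p" "80 \<le> p" and m: "2 \<le> m" "m \<le> p - 2"
    and c: "0 < c" "3 / 10 + 1 / (2 * real p) \<le> c" "c \<le> 1 / 3 + 1 / real p"
    and Q: "k * (k + 3) / 2 \<le> c * p * sin (pi / p) / sin (pi * c / 3)"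
  shows "d_mod m p < c"
proof -
  let ?K = "card ` {A. m_sum_free_mod p m A}"
  have "{A. m_sum_free_mod p m A} \<subseteq> Pow {..<p}"
    by (auto simp: m_sum_free_mod_def)
  then have "finite ?K"
    by (meson finite_Pow_iff finite_imageI finite_lessThan finite_subset)
  moreover have "m_sum_free_mod p m {}"
    by (simp add: m_sum_free_mod_def)
  then have "?K \<noteq> {}"
    by blast
  ultimately have "Max ?K \<in> ?K"
    by (rule Max_in)
  then obtain A where A: "m_sum_free_mod p m A" "Max ?K = card A"
    by auto
  have "real (card (int ` A)) < c * p"
  proof (rule solution_free_card_less[OF p, of "int m"])
    show "2 \<le> int m" "int m \<le> int p - 2"
      using m p by auto
    show "int ` A \<subseteq> {0..<int p}"
      using A(1) by (auto simp: m_sum_free_mod_def)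
    fix x y z assume "x \<in> int ` A" "y \<in> int ` A" "z \<in> int ` A"
    then obtain a b d where abd: "a \<in> A" "b \<in> A" "d \<in> A" "x = int a" "y = int b" "z = int d"
      by auto
    then have "(a + b) mod p \<noteq> (m * d) mod p"
      using A(1) by (auto simp: m_sum_free_mod_def)
    then show "\<not> [x + y = int m * z] (mod int p)"
      using abd by (simp add: cong_def flip: of_nat_add of_nat_mult of_nat_mod)
  qed (use c Q in \<open>auto simp: k_def\<close>)
  then have "real (card A) < c * p"
    by (simp add: card_image)
  then show ?thesis
    using A(2) p(2) by (simp add: d_mod_def pos_divide_less_eq)
qed

section \<open>Numerical estimates for \<open>c\<close>\<close>

lemma mult_sin_pi_div_ge_3:
  fixes p :: real
  assumes "6 \<le> p"
  shows "3 \<le> p * sin (pi / p)"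
  using sin_mult_le[of "p / 6" "pi / p"] assms by (simp add: sin_30)

text \<open>Crude bounds on \<open>Q\<close> locate \<open>c\<close>: 2 and 3.68 are the values at
  which \<open>8 * Q + 9\<close> is the square of 5 and of 6.2. Thus \<open>4 + 12 / p\<close> lies
  between \<open>12 * c\<close> and \<open>13.2 * c\<close>, which gives both range conditions on
  \<open>c\<close>.\<close>

lemma d_mod_less_solution:
  fixes p m :: nat and c :: real
  assumes p: "prime p" "80 \<le> p" and m: "2 \<le> m" "m \<le> p - 2" and c: "0 < c" "c < 1"
    and eq: "(7 + sqrt (8 * c * real p * sin (pi / real p) / sin (pi * c / 3) + 9)) * c = 4 + 12 / real p"
  shows "d_mod m p < c"
proof -
  define Q where "Q = c * p * sin (pi / p) / sin (pi * c / 3)"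
  define s where "s = sqrt (8 * Q + 9)"
  have p0: "80 \<le> real p"
    using p(2) by simp
  have eq: "(7 + s) * c = 4 + 12 / real p"
    using eq by (simp add: s_def Q_def mult.assoc)
  have s3: "0 < sin (pi * c / 3)"
    using c by (intro sin_gt_zero) (auto simp: field_simps)
  have "2 \<le> Q"
  proof -
    have "2 * sin (pi * c / 3) \<le> 2 * (pi * c / 3)"
      using c by (intro mult_left_mono sin_x_le_x) auto
    also have "\<dots> \<le> c * 3"
      using c pi_less_4 by (simp add: field_simps)
    also have "\<dots> \<le> c * (p * sin (pi / p))"
      using c p0 by (intro mult_left_mono mult_sin_pi_div_ge_3) auto
    finally show ?thesis
      using s3 by (simp add: Q_def pos_le_divide_eq mult.assoc)
  qed
  have "Q \<le> 368 / 100"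
  proof -
    have "c * (sqrt 3 / 2) \<le> sin (pi * c / 3)"
      using sin_mult_le[of "1 / c" "pi * c / 3"] c by (simp add: sin_60 field_simps)
    moreover have "c * (173 / 200) \<le> c * (sqrt 3 / 2)"
      using c real_le_rsqrt[of "173 / 100" 3] by (intro mult_left_mono) (auto simp: power2_eq_square)
    ultimately have "368 / 100 * (c * (173 / 200)) \<le> 368 / 100 * sin (pi * c / 3)"
      by simp
    moreover have "c * (p * sin (pi / p)) \<le> c * pi"
    proof (intro mult_left_mono)
      have "real p * sin (pi / p) \<le> p * (pi / p)"
        by (intro mult_left_mono sin_x_le_x) auto
      then show "p * sin (pi / p) \<le> pi"
        using p0 by simp
    qed (use c in auto)
    moreover have "c * pi \<le> c * (318 / 100)"
      using c pi_approx by (intro mult_left_mono) auto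
    ultimately have "c * (p * sin (pi / p)) \<le> 368 / 100 * sin (pi * c / 3)"
      using c(1) by linarith
    then show ?thesis
      using s3 by (simp add: Q_def pos_divide_le_eq mult.assoc)
  qed
  have s: "5 \<le> s"
    unfolding s_def using \<open>2 \<le> Q\<close> by (intro real_le_rsqrt) (simp add: power2_eq_square)
  have s': "s \<le> 62 / 10"
    unfolding s_def using \<open>2 \<le> Q\<close> \<open>Q \<le> 368 / 100\<close>
    by (intro real_le_lsqrt) (simp_all add: power2_eq_square)
  have "12 * c \<le> 4 + 12 / real p"
    unfolding eq[symmetric] using s c by (intro mult_right_mono) auto
  then have c1: "c \<le> 1 / 3 + 1 / real p"
    by simp
  have "4 + 12 / real p \<le> (132 / 10) * c"
    unfolding eq[symmetric] using s' c by (intro mult_right_mono) auto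
  then have c2: "3 / 10 + 1 / (2 * real p) \<le> c"
    using p0 by (simp add: field_simps)
  define k where "k = 2 / c + 6 / (c * p) - 5"
  \<comment> \<open>Squaring this turns the equation for \<open>c\<close> into the quadratic
    condition of \<open>d_mod_less\<close>, with equality.\<close>
  have "2 * k + 3 = s"
    using eq c p0 by (simp add: k_def field_simps)
  then have "(2 * k + 3)\<^sup>2 = 8 * Q + 9"
    using \<open>2 \<le> Q\<close> by (simp add: s_def)
  then have "k * (k + 3) / 2 = Q"
    by (simp add: power2_eq_square algebra_simps)
  then show ?thesis
    using d_mod_less[OF p m c(1) c2 c1] by (simp add: k_def Q_def)
qed

text \<open>With \<open>x = pi * c / 3\<close> the right side is \<open>3 * x / sin x\<close>. The
  left side is about 3.0539, and its product with the bound \<open>r = 0.9822\<close> for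
  \<open>sin x / x\<close> is about 2.9996, just below 3; hence the Taylor estimate up to the fifth
  power.\<close>

lemma limit_density_numeric:
  fixes c :: real
  defines "c \<equiv> 1 / 3.1955"
  shows "(2 / c - 5) * ((2 / c - 5) + 3) / 2 < c * pi / sin (pi * c / 3)"
proof -
  define x where "x = pi * c / 3"
  have x: "3277 / 10000 \<le> x" "x \<le> 3278 / 10000"
    using pi_approx by (simp_all add: x_def c_def)
  define r :: real where "r = 98220 / 100000"
  have "\<bar>sin x - (\<Sum>m<5. sin_coeff m * x ^ m)\<bar> \<le> inverse (fact 5) * \<bar>x\<bar> ^ 5"
    by (rule Maclaurin_sin_bound)
  moreover have "(\<Sum>m<5. sin_coeff m * x ^ m) = x - x ^ 3 / 6"
    by (simp add: sin_coeff_def lessThan_nat_numeral lessThan_Suc fact_numeral)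
  moreover have "inverse (fact 5) * \<bar>x\<bar> ^ 5 = x ^ 5 / 120"
    using x by (simp add: fact_numeral)
  ultimately have "sin x \<le> x - x ^ 3 / 6 + x ^ 5 / 120"
    by linarith
  also have "\<dots> = x * (1 - x\<^sup>2 / 6 + x ^ 4 / 120)"
    by (simp add: power2_eq_square eval_nat_numeral algebra_simps)
  also have "\<dots> \<le> x * r"
  proof (rule mult_left_mono)
    have "(3277 / 10000)\<^sup>2 \<le> x\<^sup>2" "x ^ 4 \<le> (3278 / 10000) ^ 4"
      using x by (auto intro!: power_mono)
    then show "1 - x\<^sup>2 / 6 + x ^ 4 / 120 \<le> r"
      by (simp add: r_def power2_eq_square eval_nat_numeral)
  qed (use x in auto)
  finally have sin: "sin x \<le> x * r" .
  have "0 < sin x"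
    using x pi_gt3 by (intro sin_gt_zero) auto
  have "(2 / c - 5) * ((2 / c - 5) + 3) / 2 * (x * r) < 3 * x"
    using x by (simp add: c_def r_def)
  moreover have "(2 / c - 5) * ((2 / c - 5) + 3) / 2 * sin x \<le> (2 / c - 5) * ((2 / c - 5) + 3) / 2 * (x * r)"
    using sin by (intro mult_left_mono) (auto simp: c_def)
  ultimately have "(2 / c - 5) * ((2 / c - 5) + 3) / 2 * sin x < 3 * x"
    by linarith
  then show ?thesis
    using \<open>0 < sin x\<close> by (simp add: x_def pos_less_divide_eq mult.commute)
qed

text \<open>Since \<open>d_mod_less\<close> asks only for an inequality, one constant
  \<open>c\<close> serves all large \<open>p\<close>: the strict inequality in the limit persists,
  and the solutions \<open>c(p)\<close> need not be followed.\<close>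

lemma eventually_d_mod_less:
  assumes "3 \<le> m"
  shows "eventually (\<lambda>p. prime p \<longrightarrow> d_mod m p < 1 / 3.1955) at_top"
proof -
  define c :: real where "c = 1 / 3.1955"
  have c: "0 < c" "3 / 10 < c" "c < 1 / 3"
    by (simp_all add: c_def)
  have k: "((\<lambda>p. 2 / c + 6 / (c * real p) - 5) \<longlongrightarrow> 2 / c + 0 - 5) at_top"
    using c(1) by (intro tendsto_intros) real_asymp
  have "((\<lambda>p. c * real p * sin (pi / real p)) \<longlongrightarrow> c * pi) at_top"
    by real_asymp
  then have "((\<lambda>p. c * real p * sin (pi / real p) / sin (pi * c / 3)) \<longlongrightarrow> c * pi / sin (pi * c / 3)) at_top"
    using sin_gt_zero[of "pi * c / 3"] c by (intro tendsto_divide[OF _ tendsto_const]) auto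
  then have "((\<lambda>p. c * real p * sin (pi / real p) / sin (pi * c / 3)
      - ((2 / c + 6 / (c * real p) - 5) * ((2 / c + 6 / (c * real p) - 5) + 3) / 2))
      \<longlongrightarrow> c * pi / sin (pi * c / 3) - (2 / c + 0 - 5) * ((2 / c + 0 - 5) + 3) / 2) at_top"
    by (rule tendsto_diff[OF _ tendsto_divide[OF tendsto_mult[OF k tendsto_add[OF k tendsto_const]] tendsto_const]]) simp
  moreover have "0 < c * pi / sin (pi * c / 3) - (2 / c + 0 - 5) * ((2 / c + 0 - 5) + 3) / 2"
    using limit_density_numeric by (simp add: c_def)
  ultimately have "eventually (\<lambda>p. 0 < c * real p * sin (pi / real p) / sin (pi * c / 3)
      - (2 / c + 6 / (c * real p) - 5) * ((2 / c + 6 / (c * real p) - 5) + 3) / 2) at_top"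
    by (rule order_tendstoD)
  then show ?thesis
    using eventually_ge_at_top[of "m + 80"]
  proof eventually_elim
    case (elim p)
    show ?case
    proof
      assume "prime p"
      have "80 \<le> real p"
        using elim by simp
      then have "3 / 10 + 1 / (2 * real p) \<le> c" "c \<le> 1 / 3 + 1 / real p"
        by (simp_all add: c_def field_simps)
      then show "d_mod m p < 1 / 3.1955"
        unfolding c_def[symmetric] using \<open>prime p\<close> elim assms c(1) by (intro d_mod_less) auto
    qed
  qed
qed

theorem theorem1p5:
  shows "(\<forall>(p::nat) (m::nat) (c::real).
            prime p \<longrightarrow> 80 \<le> p \<longrightarrow> 2 \<le> m \<longrightarrow> m \<le> p - 2 \<longrightarrow>
            0 < c \<longrightarrow> c < 1 \<longrightarrow>
            (7 + sqrt (8 * c * real p * sin (pi / real p) / sin (pi * c / 3) + 9)) * c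
               = 4 + 12 / real p \<longrightarrow>
            d_mod m p < c)
       \<and> (\<forall>(m::nat) (L::real). 3 \<le> m \<longrightarrow>
            filterlim (d_mod m) (nhds L) primes_at_top \<longrightarrow>
            L \<le> 1 / 3.1955)"
proof (intro conjI allI impI)
  fix m :: nat and L :: real
  assume "3 \<le> m" and lim: "filterlim (d_mod m) (nhds L) primes_at_top"
  have "eventually (\<lambda>p. d_mod m p \<le> 1 / 3.1955) primes_at_top"
    using eventually_d_mod_less[OF \<open>3 \<le> m\<close>]
    by (auto simp: primes_at_top_def eventually_inf_principal elim!: eventually_mono)
  moreover have "primes_at_top \<noteq> bot"
  proof -
    have "\<not> eventually (\<lambda>p::nat. \<not> prime p) at_top"
      using bigger_prime by (auto simp: eventually_at_top_linorder) (meson less_imp_le)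
    then show ?thesis
      by (simp add: primes_at_top_def trivial_limit_def eventually_inf_principal)
  qed
  ultimately show "L \<le> 1 / 3.1955"
    using tendsto_upperbound[OF lim] by blast
qed (rule d_mod_less_solution)

end
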